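(* Assume Case (III) holds with $\mathrm{rank}(\mathbf H)=m$, and let $\mathbf y^\star$ be the unique least squares solution of $\mathbf z=\mathbf H\mathbf y$. Assume [A1] and [A2]. Then for every $\epsilon>0$ and every initial value $\mathbf x(0)\in\mathcal A_1\times\cdots\times\mathcal A_N$ there exist constants $K_\ast(\epsilon,\mathbf x(0))>0$ and $T_\ast(\epsilon,\mathbf x(0))>0$ such that: whenever $\mathrm G_{\sigma(t)}$ is balanced for all $t$ and $\delta$-UJSC with respect to some $T\le T_\ast$, and $K\ge K_\ast$, the trajectory of the "consensus + projection" flow from $\mathbf x(0)$ satisfies $\limsup_{t\to\infty}\|\mathbf x_i(t)-\mathbf y^\star\|\le\epsilon$ for all $i\in\mathrm V$.
   Context: Setting: $N,m\ge 1$; $\mathbf H\in\mathbb R^{N\times m}$ has rows $\mathbf h_1^{T},\dots,\mathbf h_N^{T}$ with $\|\mathbf h_i\|=1$; $\mathbf z=(z_1,\dots,z_N)^T$. $\mathcal A_i=\{\mathbf y\in\mathbb R^m:\mathbf h_i^T\mathbf y=z_i\}$, $\mathcal P_{\mathcal A_i}(\mathbf y)=(I-\mathbf h_i\mathbf h_i^T)\mathbf y+z_i\mathbf h_i$ its Euclidean projection. Case (III): $\mathbf z$ is not in the column space of $\mathbf H$; the least squares solution is $\mathbf y^\star=(\mathbf H^T\mathbf H)^{-1}\mathbf H^T\mathbf z$. [A1]: for every $\mathbf y\in\mathbb R^m$ the set $\mathcal W(\mathbf y)=\{\mathcal P_{\mathcal A_{i_J}}\cdots\mathcal P_{\mathcal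 A_{i_1}}(\mathbf y): i_1,\dots,i_J\in\mathrm V,\ J\ge1\}$ is bounded. [A2]: $\sum_{i=1}^N\mathcal P_{\mathcal A_i}(0)=0$. Network: $\mathrm V=\{1,\dots,N\}$; graph signal $t\mapsto\mathrm G_{\sigma(t)}=(\mathrm V,\mathrm E_{\sigma(t)})$ of digraphs, $\mathrm N_i(t)=\{j:(j,i)\in\mathrm E_{\sigma(t)}\}$; weights $a_{ij}:[0,\infty)\to(0,\infty)$ continuous except on a null set and bounded by some $a^\ast>0$. Balanced: $\sum_{j\in\mathrm N_i(t)}a_{ij}(t)=\sum_{j:\,i\in\mathrm N_j(t)}a_{ji}(t)$ for all $i,t$. An arc $(j,i)$ is a $\delta$-arc on $[t_1,t_2)$ if $\int_{t_1}^{t_2}a_{ij}(t)\mathbb I_{(j,i)\in\mathrm E_{\sigma(t)}}dt\ge\delta$; $\mathrm G_{\sigma(t)}$ is $\delta$-UJSC with respect to $T>0$ if for every $s\ge0$ the $\delta$-arcs on $[s,s+T)$ form a strongly connected digraph. The "consensus + projection" flow with gain $K>0$ is $\dot{\mathbf x}_i=K\sum_{j\in\mathrm N_i(t)}a_{ij}(t)(\mathbf x_j-\mathbf x_i)+\mathcal P_{\mathcal A_i}(\mathbf x_i)-\mathbf x_i$, $i\in\mathrm V$. *)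

theory Defs
  imports "HOL-Analysis.Analysis"
begin

text \<open>Nodes are the elements of a finite type 'n (so V = UNIV, N = CARD('n));
  the state space is real^'m (m = CARD('m)).  H :: real^'m^'n has rows H$i = h_i.\<close>

definition proj :: "real^'m^'n \<Rightarrow> real^'n \<Rightarrow> 'n \<Rightarrow> real^'m \<Rightarrow> real^'m" where
  "proj H z i y = y - ((H$i) \<bullet> y) *\<^sub>R (H$i) + (z$i) *\<^sub>R (H$i)"

text \<open>P_{i_J} ... P_{i_1} (y) for the index list [i_1, ..., i_J].\<close>
definition proj_seq :: "real^'m^'n \<Rightarrow> real^'n \<Rightarrow> 'n list \<Rightarrow> real^'m \<Rightarrow> real^'m" where
  "proj_seq H z is y = fold (proj H z) is y"

definition W_set :: "real^'m^'n \<Rightarrow> real^'n \<Rightarrow> real^'m \<Rightarrow> (real^'m) set" where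
  "W_set H z y = {proj_seq H z is y | is. is \<noteq> []}"

definition A1 :: "real^'m^'n \<Rightarrow> real^'n \<Rightarrow> bool" where
  "A1 H z \<longleftrightarrow> (\<forall>y. bounded (W_set H z y))"

definition A2 :: "real^'m^'n \<Rightarrow> real^'n \<Rightarrow> bool" where
  "A2 H z \<longleftrightarrow> (\<Sum>i\<in>UNIV. proj H z i 0) = 0"

text \<open>Graph signal: E t is the arc set at time t; (j,i) \<in> E t means j \<in> N_i(t).\<close>
definition nbrs :: "(real \<Rightarrow> ('n \<times> 'n) set) \<Rightarrow> real \<Rightarrow> 'n \<Rightarrow> 'n set" where
  "nbrs E t i = {j. (j, i) \<in> E t}"

text \<open>Admissible weights: positive, bounded by some a* > 0, continuous on [0,\<infinity>)
  except on a Lebesgue null set.\<close>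
definition admissible_weights :: "('n \<Rightarrow> 'n \<Rightarrow> real \<Rightarrow> real) \<Rightarrow> bool" where
  "admissible_weights a \<longleftrightarrow>
     (\<forall>i j t. t \<ge> 0 \<longrightarrow> a i j t > 0) \<and>
     (\<exists>astar>0. \<forall>i j t. t \<ge> 0 \<longrightarrow> a i j t \<le> astar) \<and>
     (\<forall>i j. \<exists>S \<in> null_sets lborel. \<forall>t. t \<ge> 0 \<and> t \<notin> S \<longrightarrow>
          continuous (at t within {0..}) (a i j))"

definition balanced :: "(real \<Rightarrow> ('n \<times> 'n) set) \<Rightarrow> ('n \<Rightarrow> 'n \<Rightarrow> real \<Rightarrow> real) \<Rightarrow> bool" where
  "balanced E a \<longleftrightarrow> (\<forall>i t. t \<ge> 0 \<longrightarrow>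
     (\<Sum>j\<in>nbrs E t i. a i j t) = (\<Sum>j\<in>{j. i \<in> nbrs E t j}. a j i t))"

definition delta_arc :: "(real \<Rightarrow> ('n \<times> 'n) set) \<Rightarrow> ('n \<Rightarrow> 'n \<Rightarrow> real \<Rightarrow> real) \<Rightarrow> real
    \<Rightarrow> real \<Rightarrow> real \<Rightarrow> 'n \<Rightarrow> 'n \<Rightarrow> bool" where
  "delta_arc E a \<delta> t1 t2 j i \<longleftrightarrow>
     (\<integral>\<^sup>+ t. ennreal (a i j t * (if (j, i) \<in> E t then 1 else 0)) * indicator {t1..<t2} t \<partial>lborel)
       \<ge> ennreal \<delta>"

definition strongly_connected :: "('n \<times> 'n) set \<Rightarrow> bool" where
  "strongly_connected D \<longleftrightarrow> (\<forall>u v. (u, v) \<in> D\<^sup>*)"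

definition UJSC :: "(real \<Rightarrow> ('n \<times> 'n) set) \<Rightarrow> ('n \<Rightarrow> 'n \<Rightarrow> real \<Rightarrow> real) \<Rightarrow> real \<Rightarrow> real \<Rightarrow> bool" where
  "UJSC E a \<delta> T \<longleftrightarrow> (\<forall>s\<ge>0. strongly_connected {(j, i). delta_arc E a \<delta> s (s + T) j i})"

text \<open>Right-hand side of the "consensus + projection" flow with gain K.\<close>
definition flow_rhs :: "real^'m^'n \<Rightarrow> real^'n \<Rightarrow> real \<Rightarrow> (real \<Rightarrow> ('n \<times> 'n) set)
    \<Rightarrow> ('n \<Rightarrow> 'n \<Rightarrow> real \<Rightarrow> real) \<Rightarrow> ('n \<Rightarrow> real \<Rightarrow> real^'m) \<Rightarrow> 'n \<Rightarrow> real \<Rightarrow> real^'m" where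
  "flow_rhs H z K E a x i t =
     K *\<^sub>R (\<Sum>j\<in>nbrs E t i. a i j t *\<^sub>R (x j t - x i t)) + proj H z i (x i t) - x i t"

text \<open>Trajectory (Caratheodory solution) on [0,\<infinity>) from initial value x0.\<close>
definition is_trajectory :: "real^'m^'n \<Rightarrow> real^'n \<Rightarrow> real \<Rightarrow> (real \<Rightarrow> ('n \<times> 'n) set)
    \<Rightarrow> ('n \<Rightarrow> 'n \<Rightarrow> real \<Rightarrow> real) \<Rightarrow> ('n \<Rightarrow> real^'m) \<Rightarrow> ('n \<Rightarrow> real \<Rightarrow> real^'m) \<Rightarrow> bool" where
  "is_trajectory H z K E a x0 x \<longleftrightarrow>
     (\<forall>i. x i 0 = x0 i) \<and>
     (\<forall>i t. t \<ge> 0 \<longrightarrow> (flow_rhs H z K E a x i has_integral (x i t - x0 i)) {0..t})"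

end

theory Submission
  imports Defs
begin

text \<open>
  Assumption [A2] says \<open>H\<^sup>T z = 0\<close>, so \<open>y\<^sup>\<star> = 0\<close>. Fix \<open>K\<^sub>\<star> = 1\<close> and let \<open>T\<close> be small.

  In each coordinate the flow is a balanced scalar consensus system with bounded forcing. On a
  window of length \<open>T\<close> choose a cut \<open>(A, V - A)\<close> across which the sorted values have a gap of at
  least \<open>1/N\<close> of their spread. While the gap stays open, the decrease of \<open>\<Sum>\<^sub>A y\<^sub>i\<close> controls both the
  narrowing of the gap (from above) and the dissipation of the variance (from below), and balance
  makes the two cut weights equal. Hence either the gap halves, or the \<open>\<delta>\<close>-arc across the cut acts
  for the whole window; in both cases the variance contracts by a factor depending only on \<open>N\<close> and
  \<open>\<delta>\<close>, with no reference to the upper bound \<open>a\<^sup>*\<close> of the weights.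

  The mean obeys \<open>x' = - H\<^sup>T H x / N\<close> up to the disagreement, so \<open>|mean|\<^sup>2 + variance\<close> satisfies
  \<open>U(s + T) \<le> (1 - c T) U(s) + C T\<^sup>2\<close>, and its upper limit is \<open>O(T)\<close>.
\<close>

text \<open>The constants must be fixed before the graph, the weights and the gain are known, so the
  weight carried by an arc during a window has a positive lower bound but no upper bound that may
  enter an estimate. Comparison arguments with factors like exp(- weight * time) are therefore
  useless. The proof replaces time by a clock that scales with the weights: the fall of the sum over
  the upper group, which records how much weight has acted across the cut. Eliminating the unknown
  cut weight between two inequalities leaves only ratios such as spread / gap. The recursion for U
  mixes two speeds. Per window the variance loses a fixed fraction, the mean only a fraction of
  order T. The projection force displaces a node by O(T) during a window, which costs O(T^2) in the
  squares; its part proportional to U is absorbed for small T, and dividing the remaining C T^2 by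
  the rate c T gives the O(T) limit. The error that disagreement causes in the mean is of order T
  times the variance, and is paid for by the fast contraction of the variance.\<close>

section \<open>Balanced weights\<close>

lemma sum_UNIV_split:
  fixes g :: "'n::finite \<Rightarrow> real"
  shows "(\<Sum>j\<in>UNIV. g j) = (\<Sum>j\<in>A. g j) + (\<Sum>j\<in>-A. g j)"
  using sum.union_disjoint[of A "-A" g] by (simp add: Compl_partition)

text \<open>Summed over \<open>A\<close>, the balance equations count every arc inside
  \<open>A\<close> on both sides; what remains after cancellation is the cut.\<close>

lemma balanced_cut:
  fixes b :: "'n::finite \<Rightarrow> 'n \<Rightarrow> real"
  assumes bal: "\<And>i. (\<Sum>j\<in>UNIV. b i j) = (\<Sum>j\<in>UNIV. b j i)"
  shows "(\<Sum>i\<in>A. \<Sum>j\<in>-A. b i j) = (\<Sum>i\<in>A. \<Sum>j\<in>-A. b j i)"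
proof -
  have "(\<Sum>i\<in>A. \<Sum>j\<in>UNIV. b i j) = (\<Sum>i\<in>A. \<Sum>j\<in>UNIV. b j i)"
    using bal by simp
  then have "(\<Sum>i\<in>A. \<Sum>j\<in>A. b i j) + (\<Sum>i\<in>A. \<Sum>j\<in>-A. b i j)
      = (\<Sum>i\<in>A. \<Sum>j\<in>A. b j i) + (\<Sum>i\<in>A. \<Sum>j\<in>-A. b j i)"
    by (simp only: sum_UNIV_split[of _ A] sum.distrib)
  moreover have "(\<Sum>i\<in>A. \<Sum>j\<in>A. b i j) = (\<Sum>i\<in>A. \<Sum>j\<in>A. b j i)"
    by (rule sum.swap)
  ultimately show ?thesis by simp
qed

text \<open>Balance lets the loss of node \<open>i\<close> be charged to the weights
  \<open>b j i\<close>. In this form a sum over a group is a double sum minus its transpose, so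
  internal exchange cancels in \<open>cut_flux\<close>.\<close>

lemma balanced_row_rewrite:
  fixes b :: "'n::finite \<Rightarrow> 'n \<Rightarrow> real"
  assumes bal: "\<And>i. (\<Sum>j\<in>UNIV. b i j) = (\<Sum>j\<in>UNIV. b j i)"
  shows "(\<Sum>j\<in>UNIV. b i j * (y j - y i)) = (\<Sum>j\<in>UNIV. b i j * y j - b j i * y i)"
proof -
  have "(\<Sum>j\<in>UNIV. b i j * y i) = (\<Sum>j\<in>UNIV. b j i * y i)"
    using bal by (simp only: sum_distrib_right[symmetric])
  then show ?thesis by (simp add: right_diff_distrib sum_subtractf)
qed

lemma cut_flux:
  fixes b :: "'n::finite \<Rightarrow> 'n \<Rightarrow> real"
  assumes bal: "\<And>i. (\<Sum>j\<in>UNIV. b i j) = (\<Sum>j\<in>UNIV. b j i)"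
  shows "(\<Sum>i\<in>A. \<Sum>j\<in>UNIV. b i j * (y j - y i))
    = (\<Sum>i\<in>A. \<Sum>j\<in>-A. b i j * y j - b j i * y i)"
proof -
  have "(\<Sum>i\<in>A. \<Sum>j\<in>A. b i j * y j) = (\<Sum>i\<in>A. \<Sum>j\<in>A. b j i * y i)"
    by (rule sum.swap)
  then have "(\<Sum>i\<in>A. \<Sum>j\<in>A. b i j * y j - b j i * y i) = 0"
    by (simp add: sum_subtractf)
  then show ?thesis
    by (simp only: balanced_row_rewrite[OF bal] sum_UNIV_split[of _ A] sum.distrib)
qed

text \<open>Every value in \<open>A\<close> is at least \<open>c\<close> and every value outside is
  at most \<open>c - \<gamma>\<close>. Since both directions of the cut carry the same total weight,
  the level \<open>c\<close> drops out and only \<gamma> survives.\<close>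

lemma cut_flux_le:
  fixes b :: "'n::finite \<Rightarrow> 'n \<Rightarrow> real"
  assumes bal: "\<And>i. (\<Sum>j\<in>UNIV. b i j) = (\<Sum>j\<in>UNIV. b j i)"
    and nonneg: "\<And>i j. 0 \<le> b i j"
    and gap: "\<And>i j. i \<in> A \<Longrightarrow> j \<notin> A \<Longrightarrow> \<gamma> \<le> y i - y j"
  shows "(\<Sum>i\<in>A. \<Sum>j\<in>UNIV. b i j * (y j - y i)) \<le> - \<gamma> * (\<Sum>i\<in>A. \<Sum>j\<in>-A. b i j)"
proof (cases "A = {}")
  case False
  define c where "c = Min (y ` A)"
  have c1: "c \<le> y i" if "i \<in> A" for i using that by (simp add: c_def)
  have "c \<in> y ` A" unfolding c_def by (rule Min_in) (use False in auto)
  then have c2: "y j \<le> c - \<gamma>" if "j \<notin> A" for j using gap that by fastforce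
  have "(\<Sum>i\<in>A. \<Sum>j\<in>UNIV. b i j * (y j - y i))
      = (\<Sum>i\<in>A. \<Sum>j\<in>-A. b i j * y j - b j i * y i)"
    by (rule cut_flux[OF bal])
  also have "\<dots> \<le> (\<Sum>i\<in>A. \<Sum>j\<in>-A. b i j * (c - \<gamma>) - b j i * c)"
    by (intro sum_mono diff_mono mult_left_mono) (auto simp: nonneg c1 c2)
  also have "\<dots> = (\<Sum>i\<in>A. \<Sum>j\<in>-A. b i j) * (c - \<gamma>) - (\<Sum>i\<in>A. \<Sum>j\<in>-A. b j i) * c"
    by (simp only: sum_subtractf sum_distrib_right)
  also have "\<dots> = - \<gamma> * (\<Sum>i\<in>A. \<Sum>j\<in>-A. b i j)"
    by (simp add: balanced_cut[OF bal, of A, symmetric] algebra_simps)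
  finally show ?thesis .
qed simp

text \<open>The extreme configuration puts all of \<open>A\<close> at the top of the range and the
  complement at the bottom; equal cut weights again remove the level \<open>c\<close>.\<close>

lemma cut_flux_ge:
  fixes b :: "'n::finite \<Rightarrow> 'n \<Rightarrow> real"
  assumes bal: "\<And>i. (\<Sum>j\<in>UNIV. b i j) = (\<Sum>j\<in>UNIV. b j i)"
    and nonneg: "\<And>i j. 0 \<le> b i j"
    and range: "\<And>i j. y i - y j \<le> R"
  shows "- R * (\<Sum>i\<in>A. \<Sum>j\<in>-A. b i j) \<le> (\<Sum>i\<in>A. \<Sum>j\<in>UNIV. b i j * (y j - y i))"
proof -
  define c where "c = Min (range y)"
  have c1: "c \<le> y i" for i by (simp add: c_def)
  have "c \<in> range y" unfolding c_def by (rule Min_in) auto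
  then have c2: "y j \<le> c + R" for j using range by (auto simp: algebra_simps)
  have "- R * (\<Sum>i\<in>A. \<Sum>j\<in>-A. b i j)
      = (\<Sum>i\<in>A. \<Sum>j\<in>-A. b i j) * c - (\<Sum>i\<in>A. \<Sum>j\<in>-A. b j i) * (c + R)"
    by (simp add: balanced_cut[OF bal, of A, symmetric] algebra_simps)
  also have "\<dots> = (\<Sum>i\<in>A. \<Sum>j\<in>-A. b i j * c - b j i * (c + R))"
    by (simp only: sum_subtractf sum_distrib_right)
  also have "\<dots> \<le> (\<Sum>i\<in>A. \<Sum>j\<in>-A. b i j * y j - b j i * y i)"
    by (intro sum_mono diff_mono mult_left_mono) (auto simp: nonneg c1 c2)
  also have "\<dots> = (\<Sum>i\<in>A. \<Sum>j\<in>UNIV. b i j * (y j - y i))"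
    by (rule cut_flux[OF bal, symmetric])
  finally show ?thesis .
qed

text \<open>Write 2 y_i (y_j - y_i) as y_j^2 - y_i^2 - (y_j - y_i)^2; the difference of squares sums
  to zero by balance.\<close>

lemma balanced_dissipation:
  fixes b :: "'n::finite \<Rightarrow> 'n \<Rightarrow> real"
  assumes bal: "\<And>i. (\<Sum>j\<in>UNIV. b i j) = (\<Sum>j\<in>UNIV. b j i)"
  shows "(\<Sum>i\<in>UNIV. 2 * y i * (\<Sum>j\<in>UNIV. b i j * (y j - y i)))
    = - (\<Sum>i\<in>UNIV. \<Sum>j\<in>UNIV. b i j * (y j - y i)\<^sup>2)"
proof -
  have "(\<Sum>i\<in>UNIV. \<Sum>j\<in>UNIV. b i j * (y j)\<^sup>2) = (\<Sum>j\<in>UNIV. \<Sum>i\<in>UNIV. b i j * (y j)\<^sup>2)"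
    by (rule sum.swap)
  also have "\<dots> = (\<Sum>j\<in>UNIV. \<Sum>i\<in>UNIV. b j i * (y j)\<^sup>2)"
    using bal by (simp only: sum_distrib_right[symmetric])
  finally have *: "(\<Sum>i\<in>UNIV. \<Sum>j\<in>UNIV. b i j * (y j)\<^sup>2 - b i j * (y i)\<^sup>2) = 0"
    by (simp add: sum_subtractf)
  have "(\<Sum>i\<in>UNIV. 2 * y i * (\<Sum>j\<in>UNIV. b i j * (y j - y i)))
      = (\<Sum>i\<in>UNIV. \<Sum>j\<in>UNIV. (b i j * (y j)\<^sup>2 - b i j * (y i)\<^sup>2) - b i j * (y j - y i)\<^sup>2)"
    by (simp add: sum_distrib_left power2_eq_square algebra_simps)
  also have "\<dots> = - (\<Sum>i\<in>UNIV. \<Sum>j\<in>UNIV. b i j * (y j - y i)\<^sup>2)"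
    using * by (simp add: sum_subtractf)
  finally show ?thesis .
qed

section \<open>Cuts with a large gap, and arcs across them\<close>

text \<open>Pigeonhole on the upper level sets \<open>lev k\<close>, lowered by \<open>g\<close> at
  each step. If none of them were a cut with gap \<open>g\<close>, each step would gain a node, and
  \<open>lev (CARD('n) - 1)\<close> would be everything; but its threshold still lies above
  \<open>y p\<close>.\<close>

lemma exists_gap_cut:
  fixes y :: "'n::finite \<Rightarrow> real"
  assumes "y p < y q"
  shows "\<exists>A. A \<noteq> {} \<and> A \<noteq> UNIV \<and> (\<forall>i\<in>A. \<forall>j\<in>-A. (y q - y p) / real CARD('n) \<le> y i - y j)"
proof (rule ccontr)
  assume none: "\<not> ?thesis"
  define g where "g = (y q - y p) / real CARD('n)"
  define lev where "lev k = {i. y q - real k * g \<le> y i}" for k :: nat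
  have g: "g > 0" "real CARD('n) * g = y q - y p"
    using assms by (auto simp: g_def)
  have proper: "lev k \<noteq> UNIV" if "k < CARD('n)" for k
  proof -
    have "real k * g < real CARD('n) * g"
      using that g(1) by (intro mult_strict_right_mono) auto
    then have "p \<notin> lev k" using g by (auto simp: lev_def)
    then show ?thesis by auto
  qed
  have "k < CARD('n) \<Longrightarrow> Suc k \<le> card (lev k)" for k
  proof (induction k)
    case 0
    have "{q} \<subseteq> lev 0" by (auto simp: lev_def)
    then have "card {q} \<le> card (lev 0)" by (intro card_mono) auto
    then show ?case by simp
  next
    case (Suc k)
    have "q \<in> lev k" using g by (auto simp: lev_def)
    then have "\<not> (\<forall>i\<in>lev k. \<forall>j\<in>-lev k. g \<le> y i - y j)"
      using none proper[of k] Suc.prems unfolding g_def by auto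
    then have "\<exists>i\<in>lev k. \<exists>j\<in>-lev k. y i - y j < g"
      by (auto simp: not_le)
    then obtain i j where ij: "i \<in> lev k" "j \<notin> lev k" "y i - y j < g" by auto
    have "lev k \<subseteq> lev (Suc k)" using g(1) by (auto simp: lev_def algebra_simps)
    moreover have "j \<in> lev (Suc k)" using ij by (auto simp: lev_def algebra_simps)
    ultimately have "lev k \<subset> lev (Suc k)" using ij(2) by auto
    then have "card (lev k) < card (lev (Suc k))" by (intro psubset_card_mono) auto
    then show ?case using Suc by simp
  qed
  from this[of "CARD('n) - 1"] have "CARD('n) \<le> card (lev (CARD('n) - 1))" by simp
  then have "lev (CARD('n) - 1) = UNIV" by (intro card_seteq) auto
  then show False using proper[of "CARD('n) - 1"] by simp
qed

lemma strongly_connected_cut: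
  assumes "strongly_connected D" "A \<noteq> {}" "A \<noteq> UNIV"
  shows "\<exists>i\<in>A. \<exists>j\<in>-A. (j, i) \<in> D"
proof -
  obtain u v where uv: "u \<in> A" "v \<notin> A" using assms by auto
  have "(v, u) \<in> D\<^sup>*" using assms by (auto simp: strongly_connected_def)
  then have "u \<in> A \<longrightarrow> ?thesis"
    by (induction rule: rtrancl_induct) (use uv in blast)+
  then show ?thesis using uv by simp
qed

text \<open>Stands in for differentiation: trajectories are indefinite integrals of rates that are merely
  integrable, so only their increments over short intervals are compared.\<close>

lemma quadratic_increment_le:
  fixes \<phi> :: "real \<Rightarrow> real"
  assumes "s \<le> e"
    and incr: "\<And>t u. s \<le> t \<Longrightarrow> t \<le> u \<Longrightarrow> u \<le> e \<Longrightarrow> \<phi> u - \<phi> t \<le> C * (u - t)\<^sup>2"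
  shows "\<phi> e \<le> \<phi> s"
proof -
  \<comment> \<open>Cut the interval into N + 1 equal pieces of length \<open>h\<close>: the errors
    C h^2 add up to C (e - s)^2 / (N + 1), which vanishes as N grows.\<close>
  have bound: "\<phi> e - \<phi> s \<le> C * (e - s)\<^sup>2 * inverse (real (Suc N))" for N
  proof -
    define h where "h = (e - s) / real (Suc N)"
    have h: "h \<ge> 0" "real (Suc N) * h = e - s" using assms(1) by (auto simp: h_def)
    have "k \<le> Suc N \<Longrightarrow> \<phi> (s + real k * h) - \<phi> s \<le> real k * (C * h\<^sup>2)" for k
    proof (induction k)
      case (Suc k)
      have "real (Suc k) * h \<le> real (Suc N) * h"
        using Suc.prems h by (intro mult_right_mono) auto
      then have "\<phi> (s + real (Suc k) * h) - \<phi> (s + real k * h)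
          \<le> C * ((s + real (Suc k) * h) - (s + real k * h))\<^sup>2"
        using h by (intro incr) (auto simp: algebra_simps)
      also have "\<dots> = C * h\<^sup>2" by (simp add: algebra_simps)
      finally show ?case using Suc by (simp add: algebra_simps)
    qed simp
    from this[of "Suc N"] have "\<phi> e - \<phi> s \<le> real (Suc N) * (C * h\<^sup>2)"
      unfolding h(2) by simp
    also have "\<dots> = C * (e - s)\<^sup>2 * inverse (real (Suc N))"
      unfolding h_def by (simp add: power2_eq_square field_simps del: of_nat_Suc)
    finally show ?thesis .
  qed
  have "(\<lambda>N. C * (e - s)\<^sup>2 * inverse (real (Suc N))) \<longlonglongrightarrow> C * (e - s)\<^sup>2 * 0"
    by (intro tendsto_intros LIMSEQ_inverse_real_of_nat)
  then have "\<phi> e - \<phi> s \<le> C * (e - s)\<^sup>2 * 0"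
    by (rule LIMSEQ_le_const) (use bound in auto)
  then show ?thesis by simp
qed

section \<open>Scalar consensus with bounded forcing\<close>

text \<open>The upper bound on the weights is existential on purpose. It yields a Lipschitz
  constant, which enters only error terms that \<open>quadratic_increment_le\<close> removes, so no
  conclusion can depend on it.\<close>

locale balanced_flow =
  fixes y r f :: "'n::finite \<Rightarrow> real \<Rightarrow> real" and b :: "'n \<Rightarrow> 'n \<Rightarrow> real \<Rightarrow> real"
    and s e M :: real
  assumes s_le_e: "s \<le> e"
    and int: "\<And>i t u. s \<le> t \<Longrightarrow> t \<le> u \<Longrightarrow> u \<le> e \<Longrightarrow> (r i has_integral (y i u - y i t)) {t..u}"
    and rate: "\<And>i t. s \<le> t \<Longrightarrow> t \<le> e \<Longrightarrow>
      r i t = (\<Sum>j\<in>UNIV. b i j t * (y j t - y i t)) + f i t"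
    and forcing: "\<And>i t. s \<le> t \<Longrightarrow> t \<le> e \<Longrightarrow> \<bar>f i t\<bar> \<le> M"
    and nonneg: "\<And>i j t. s \<le> t \<Longrightarrow> t \<le> e \<Longrightarrow> 0 \<le> b i j t"
    and weight_bdd: "\<exists>\<beta>. \<forall>i j t. s \<le> t \<longrightarrow> t \<le> e \<longrightarrow> b i j t \<le> \<beta>"
    and bal: "\<And>i t. s \<le> t \<Longrightarrow> t \<le> e \<Longrightarrow> (\<Sum>j\<in>UNIV. b i j t) = (\<Sum>j\<in>UNIV. b j i t)"
begin

lemma M_nonneg: "0 \<le> M"
  using forcing[of s] s_le_e by (meson abs_ge_zero order_trans order_refl)

lemma restrict: "s \<le> s' \<Longrightarrow> s' \<le> e' \<Longrightarrow> e' \<le> e \<Longrightarrow> balanced_flow y r f b s' e' M"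
  using int rate forcing nonneg weight_bdd bal
  by unfold_locales (auto, meson order_trans)

lemma shift: "balanced_flow (\<lambda>i t. y i t - c) r f b s e M"
  using s_le_e int rate forcing nonneg weight_bdd bal by unfold_locales auto

text \<open>Negation turns the complement of an upper group into an upper group, so each one-sided
  estimate is proved only once.\<close>

lemma reflect: "balanced_flow (\<lambda>i t. - y i t) (\<lambda>i t. - r i t) (\<lambda>i t. - f i t) b s e M"
proof unfold_locales
  fix i t u assume "s \<le> t" "t \<le> u" "u \<le> e"
  from has_integral_neg[OF int[OF this, of i]]
  show "((\<lambda>t. - r i t) has_integral (- y i u - - y i t)) {t..u}" by simp
next
  fix i t assume "s \<le> t" "t \<le> e"
  have "(\<Sum>j\<in>UNIV. b i j t * (- y j t - - y i t)) = - (\<Sum>j\<in>UNIV. b i j t * (y j t - y i t))"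
    unfolding sum_negf[symmetric] by (intro sum.cong) (auto simp: algebra_simps)
  then show "- r i t = (\<Sum>j\<in>UNIV. b i j t * (- y j t - - y i t)) + - f i t"
    using rate[OF \<open>s \<le> t\<close> \<open>t \<le> e\<close>, of i] by simp
qed (use s_le_e forcing nonneg weight_bdd bal in auto)

lemma continuous: "continuous_on {s..e} (y i)"
proof -
  have "r i integrable_on {s..e}" using int[of s e i] s_le_e by auto
  then have "continuous_on {s..e} (\<lambda>t. y i s + integral {s..t} (r i))"
    by (intro continuous_intros indefinite_integral_continuous_1)
  moreover have "y i s + integral {s..t} (r i) = y i t" if "t \<in> {s..e}" for t
    using integral_unique[OF int[of s t i]] that by auto
  ultimately show ?thesis by (rule continuous_on_eq)
qed

lemma values_bounded: obtains Y where "0 \<le> Y" "\<And>i t. s \<le> t \<Longrightarrow> t \<le> e \<Longrightarrow> \<bar>y i t\<bar> \<le> Y"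
proof -
  have "\<exists>Y. \<forall>t\<in>{s..e}. \<bar>y i t\<bar> \<le> Y" for i
    using compact_imp_bounded[OF compact_continuous_image[OF continuous[of i] compact_Icc]]
    by (auto simp: bounded_iff)
  then obtain Y where Y: "\<And>i t. t \<in> {s..e} \<Longrightarrow> \<bar>y i t\<bar> \<le> Y i" by metis
  show ?thesis
  proof (rule that[of "\<Sum>i\<in>UNIV. \<bar>Y i\<bar>"])
    fix i t assume "s \<le> t" "t \<le> e"
    then have "\<bar>y i t\<bar> \<le> \<bar>Y i\<bar>" using Y[of t i] by auto
    also have "\<dots> \<le> (\<Sum>i\<in>UNIV. \<bar>Y i\<bar>)" by (rule member_le_sum) auto
    finally show "\<bar>y i t\<bar> \<le> (\<Sum>i\<in>UNIV. \<bar>Y i\<bar>)" .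
  qed (simp add: sum_nonneg)
qed

lemma rate_bounded: obtains L where "0 \<le> L" "\<And>i t. s \<le> t \<Longrightarrow> t \<le> e \<Longrightarrow> \<bar>r i t\<bar> \<le> L"
proof -
  obtain Y where Y: "0 \<le> Y" "\<And>i t. s \<le> t \<Longrightarrow> t \<le> e \<Longrightarrow> \<bar>y i t\<bar> \<le> Y" using values_bounded by blast
  obtain \<beta> where \<beta>: "\<And>i j t. s \<le> t \<Longrightarrow> t \<le> e \<Longrightarrow> b i j t \<le> \<beta>" using weight_bdd by blast
  have \<beta>0: "0 \<le> \<beta>" using \<beta>[of s] nonneg[of s] s_le_e by (meson order_refl order_trans)
  show ?thesis
  proof (rule that[of "real CARD('n) * (\<beta> * (2 * Y)) + M"])
    fix i t assume t: "s \<le> t" "t \<le> e"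
    have "\<bar>\<Sum>j\<in>UNIV. b i j t * (y j t - y i t)\<bar> \<le> (\<Sum>j\<in>UNIV. \<bar>b i j t * (y j t - y i t)\<bar>)"
      by (rule sum_abs)
    also have "\<dots> \<le> (\<Sum>j\<in>(UNIV::'n set). \<beta> * (2 * Y))"
    proof (rule sum_mono)
      fix j
      have "\<bar>y j t - y i t\<bar> \<le> 2 * Y" using Y(2)[OF t, of i] Y(2)[OF t, of j] by linarith
      then show "\<bar>b i j t * (y j t - y i t)\<bar> \<le> \<beta> * (2 * Y)"
        unfolding abs_mult using \<beta>[OF t] nonneg[OF t] \<beta>0 by (intro mult_mono) auto
    qed
    finally show "\<bar>r i t\<bar> \<le> real CARD('n) * (\<beta> * (2 * Y)) + M"
      using forcing[OF t, of i] rate[OF t, of i] by simp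
  qed (use Y \<beta>0 M_nonneg in simp)
qed

lemma lipschitz:
  assumes L: "\<And>i t. s \<le> t \<Longrightarrow> t \<le> e \<Longrightarrow> \<bar>r i t\<bar> \<le> L" and tu: "s \<le> t" "t \<le> u" "u \<le> e"
  shows "\<bar>y i u - y i t\<bar> \<le> L * (u - t)"
proof -
  have "0 \<le> L" using L[of s] s_le_e by (meson abs_ge_zero order_refl order_trans)
  then have "norm (y i u - y i t) \<le> L * measure lborel {t..u}"
    using L tu by (intro has_integral_bound_real[OF _ finite.emptyI int[OF tu, of i]]) auto
  then show ?thesis using tu by simp
qed

section \<open>Group sums and the motion of the extreme values\<close>

lemma sum_rate_le:
  assumes "s \<le> t" "t \<le> e" and gap: "\<And>i j. i \<in> A \<Longrightarrow> j \<notin> A \<Longrightarrow> \<gamma> \<le> y i t - y j t"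
  shows "(\<Sum>i\<in>A. r i t) \<le> - \<gamma> * (\<Sum>i\<in>A. \<Sum>j\<in>-A. b i j t) + real CARD('n) * M"
proof -
  have "(\<Sum>i\<in>A. f i t) \<le> (\<Sum>i\<in>A. M)"
    using forcing[OF assms(1,2)] by (intro sum_mono) (auto simp: abs_le_iff)
  also have "\<dots> \<le> real CARD('n) * M"
    using M_nonneg by (auto intro!: mult_right_mono card_mono)
  finally have "(\<Sum>i\<in>A. f i t) \<le> real CARD('n) * M" .
  moreover have "(\<Sum>i\<in>A. \<Sum>j\<in>UNIV. b i j t * (y j t - y i t)) \<le> - \<gamma> * (\<Sum>i\<in>A. \<Sum>j\<in>-A. b i j t)"
    by (rule cut_flux_le) (use assms nonneg bal in auto)
  ultimately show ?thesis by (simp add: rate[OF assms(1,2)] sum.distrib)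
qed

lemma sum_rate_ge:
  assumes "s \<le> t" "t \<le> e" and range: "\<And>i j. y i t - y j t \<le> R"
  shows "- R * (\<Sum>i\<in>A. \<Sum>j\<in>-A. b i j t) - real CARD('n) * M \<le> (\<Sum>i\<in>A. r i t)"
proof -
  have "- (real CARD('n) * M) \<le> (\<Sum>i\<in>A. - M)"
    using M_nonneg by (auto intro!: mult_right_mono card_mono)
  also have "\<dots> \<le> (\<Sum>i\<in>A. f i t)"
    using forcing[OF assms(1,2)] by (intro sum_mono) (auto simp: abs_le_iff minus_le_iff)
  finally have "- (real CARD('n) * M) \<le> (\<Sum>i\<in>A. f i t)" .
  moreover have "- R * (\<Sum>i\<in>A. \<Sum>j\<in>-A. b i j t) \<le> (\<Sum>i\<in>A. \<Sum>j\<in>UNIV. b i j t * (y j t - y i t))"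
    by (rule cut_flux_ge) (use assms nonneg bal in auto)
  ultimately show ?thesis by (simp add: rate[OF assms(1,2)] sum.distrib)
qed

text \<open>The minimum over \<open>A\<close> is pulled down only by the forcing and by arcs from
  outside, so it falls at rate at most R w + M, where w is the cut weight. The sum over
  \<open>A\<close> falls at rate at least \<gamma> w - n M. Eliminating w bounds the fall of the
  minimum by R / \<gamma> times the fall of the sum, up to forcing terms, however large w
  is.\<close>

lemma upper_group_lower_bound:
  assumes \<gamma>: "0 < \<gamma>" and R: "0 \<le> R" and i0: "i0 \<in> A"
    and gap: "\<And>i j t. s \<le> t \<Longrightarrow> t \<le> e \<Longrightarrow> i \<in> A \<Longrightarrow> j \<notin> A \<Longrightarrow> \<gamma> \<le> y i t - y j t"
    and range: "\<And>i j t. s \<le> t \<Longrightarrow> t \<le> e \<Longrightarrow> i \<in> A \<Longrightarrow> j \<notin> A \<Longrightarrow> y i t - y j t \<le> R"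
    and low: "\<And>i. i \<in> A \<Longrightarrow> v \<le> y i s"
  shows "v - R / \<gamma> * ((\<Sum>i\<in>A. y i s) - (\<Sum>i\<in>A. y i e) + real CARD('n) * M * (e - s)) - M * (e - s)
    \<le> y i0 e"
proof -
  define \<rho> where "\<rho> = R / \<gamma>"
  define n where "n = real CARD('n)"
  define m where "m t = Min ((\<lambda>i. y i t) ` A)" for t
  define S where "S t = (\<Sum>i\<in>A. y i t)" for t
  define \<kappa> where "\<kappa> = \<rho> * (n * M) + M"
  \<comment> \<open>The combination from which the cut weight disappears: \<rho> = R / \<gamma>
    matches the two rates in w, and \<open>\<kappa>\<close> collects the forcing terms.\<close>
  define \<phi> where "\<phi> t = - m t + \<rho> * S t - \<kappa> * t" for t
  have \<rho>: "0 \<le> \<rho>" using \<gamma> R by (simp add: \<rho>_def)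
  have \<rho>\<gamma>: "\<rho> * (\<gamma> * w) = R * w" for w using \<gamma> by (simp add: \<rho>_def)
  obtain L where L: "0 \<le> L" "\<And>i t. s \<le> t \<Longrightarrow> t \<le> e \<Longrightarrow> \<bar>r i t\<bar> \<le> L" using rate_bounded by blast
  obtain \<beta> where \<beta>: "\<And>i j t. s \<le> t \<Longrightarrow> t \<le> e \<Longrightarrow> b i j t \<le> \<beta>" using weight_bdd by blast
  have \<beta>0: "0 \<le> \<beta>" using \<beta>[of s] nonneg[of s] s_le_e by (meson order_refl order_trans)
  have m_le: "m t \<le> y i t" if "i \<in> A" for i t using that by (simp add: m_def)
  have m_att: "\<exists>i\<in>A. m t = y i t" for t
  proof -
    have "m t \<in> (\<lambda>i. y i t) ` A" unfolding m_def by (rule Min_in) (use i0 in auto)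
    then show ?thesis by auto
  qed
  have "\<phi> e \<le> \<phi> s"
  proof (rule quadratic_increment_le[OF s_le_e, where C = "2 * n * \<beta> * L"])
    fix t u assume tu: "s \<le> t" "t \<le> u" "u \<le> e"
    \<comment> \<open>A minimiser at the right end \<open>u\<close>: at \<open>t\<close> it lies
      above the minimum, so the fall of \<open>m\<close> over the piece is at most the fall of
      \<open>y i\<close>.\<close>
    obtain i where i: "i \<in> A" "m u = y i u" using m_att by blast
    have pointwise: "- r i \<sigma> + \<rho> * (\<Sum>k\<in>A. r k \<sigma>) \<le> \<kappa> + 2 * n * \<beta> * L * (u - t)"
      if \<sigma>: "\<sigma> \<in> {t..u}" for \<sigma>
    proof -
      have \<sigma>': "s \<le> \<sigma>" "\<sigma> \<le> e" "\<sigma> \<le> u" using \<sigma> tu by auto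
      define w where "w = (\<Sum>k\<in>A. \<Sum>j\<in>-A. b k j \<sigma>)"
      \<comment> \<open>Inside \<open>A\<close>, node \<open>i\<close> is minimal only at time
        \<open>u\<close>. At \<sigma> another node may lie below it, but by no more than twice the
        Lipschitz bound, so the resulting error in the increment is quadratic in
        \<open>u - t\<close>.\<close>
      have inner: "- (\<beta> * (2 * L * (u - t))) \<le> b i j \<sigma> * (y j \<sigma> - y i \<sigma>)" if j: "j \<in> A" for j
      proof -
        have "L * (u - \<sigma>) \<le> L * (u - t)" using \<sigma> L(1) by (intro mult_left_mono) auto
        moreover have "\<bar>y j u - y j \<sigma>\<bar> \<le> L * (u - \<sigma>)" "\<bar>y i u - y i \<sigma>\<bar> \<le> L * (u - \<sigma>)"
          by (rule lipschitz[OF L(2) \<sigma>'(1,3) tu(3)]; simp)+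
        moreover have "y i u \<le> y j u" using m_le[OF j, of u] i by simp
        ultimately have d: "- (2 * L * (u - t)) \<le> y j \<sigma> - y i \<sigma>" by linarith
        have "- (\<beta> * (2 * L * (u - t))) \<le> - (b i j \<sigma> * (2 * L * (u - t)))"
          using \<beta>[OF \<sigma>'(1,2)] L(1) tu by (simp add: mult_right_mono)
        also have "\<dots> \<le> b i j \<sigma> * (y j \<sigma> - y i \<sigma>)"
          using mult_left_mono[OF d nonneg[OF \<sigma>'(1,2)], of i j] by simp
        finally show ?thesis .
      qed
      have "real (card A) * (\<beta> * (2 * L * (u - t))) \<le> n * (\<beta> * (2 * L * (u - t)))"
        unfolding n_def using \<beta>0 L(1) tu
        by (intro mult_right_mono mult_nonneg_nonneg) (auto intro: card_mono)
      then have "- (n * (\<beta> * (2 * L * (u - t)))) \<le> (\<Sum>j\<in>A. - (\<beta> * (2 * L * (u - t))))"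
        by simp
      also have "\<dots> \<le> (\<Sum>j\<in>A. b i j \<sigma> * (y j \<sigma> - y i \<sigma>))"
        by (rule sum_mono) (rule inner)
      finally have in_A: "- (n * (\<beta> * (2 * L * (u - t)))) \<le> (\<Sum>j\<in>A. b i j \<sigma> * (y j \<sigma> - y i \<sigma>))" .
      have "(\<Sum>j\<in>-A. b i j \<sigma>) \<le> w"
        unfolding w_def using i(1) nonneg[OF \<sigma>'(1,2)]
        by (intro member_le_sum[of i A "\<lambda>k. \<Sum>j\<in>-A. b k j \<sigma>"]) (auto intro: sum_nonneg)
      then have "- (R * w) \<le> - (R * (\<Sum>j\<in>-A. b i j \<sigma>))" using R by (simp add: mult_left_mono)
      also have "\<dots> = (\<Sum>j\<in>-A. b i j \<sigma> * (- R))" by (simp add: sum_distrib_left sum_negf mult.commute)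
      also have "\<dots> \<le> (\<Sum>j\<in>-A. b i j \<sigma> * (y j \<sigma> - y i \<sigma>))"
        using range[OF \<sigma>'(1,2) i(1)] nonneg[OF \<sigma>'(1,2)]
        by (intro sum_mono mult_left_mono) (auto simp: algebra_simps)
      finally have out_A: "- (R * w) \<le> (\<Sum>j\<in>-A. b i j \<sigma> * (y j \<sigma> - y i \<sigma>))" .
      have "(\<Sum>k\<in>A. r k \<sigma>) \<le> - \<gamma> * w + n * M"
        unfolding w_def n_def using gap \<sigma>' by (intro sum_rate_le) auto
      from mult_left_mono[OF this \<rho>] have "\<rho> * (\<Sum>k\<in>A. r k \<sigma>) \<le> - (R * w) + \<rho> * (n * M)"
        using \<rho>\<gamma>[of w] by (simp add: right_diff_distrib)
      moreover have "r i \<sigma> = (\<Sum>j\<in>A. b i j \<sigma> * (y j \<sigma> - y i \<sigma>))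
          + (\<Sum>j\<in>-A. b i j \<sigma> * (y j \<sigma> - y i \<sigma>)) + f i \<sigma>"
        using rate[OF \<sigma>'(1,2), of i] sum_UNIV_split[of _ A] by simp
      ultimately show ?thesis
        using in_A out_A forcing[OF \<sigma>'(1,2), of i] by (simp add: \<kappa>_def algebra_simps abs_le_iff)
    qed
    have "((\<lambda>\<sigma>. - r i \<sigma> + \<rho> * (\<Sum>k\<in>A. r k \<sigma>)) has_integral
        (- (y i u - y i t) + \<rho> * (\<Sum>k\<in>A. y k u - y k t))) {t..u}"
      by (intro has_integral_add has_integral_neg has_integral_mult_right has_integral_sum int tu)
        simp
    from has_integral_le[OF this has_integral_const_real pointwise]
    have "- (y i u - y i t) + \<rho> * (\<Sum>k\<in>A. y k u - y k t)
        \<le> (u - t) * (\<kappa> + 2 * n * \<beta> * L * (u - t))"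
      using tu by simp
    then have "- (y i u - y i t) + \<rho> * (S u - S t) \<le> (u - t) * (\<kappa> + 2 * n * \<beta> * L * (u - t))"
      by (simp add: S_def sum_subtractf)
    then show "\<phi> u - \<phi> t \<le> 2 * n * \<beta> * L * (u - t)\<^sup>2"
      using m_le[OF i(1), of t] i(2) by (simp add: \<phi>_def algebra_simps power2_eq_square)
  qed
  moreover have "v \<le> m s" using m_att[of s] low by auto
  ultimately show ?thesis
    using m_le[OF i0, of e]
    by (simp add: \<phi>_def \<kappa>_def S_def \<rho>_def[symmetric] n_def algebra_simps)
qed

text \<open>The case \<open>A = UNIV\<close> with \<open>R = 0\<close>: no arc enters from outside,
  so only the forcing can lower the minimum.\<close>

lemma lower_bound:
  assumes "\<And>i. v \<le> y i s"
  shows "v - M * (e - s) \<le> y i e"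
  using upper_group_lower_bound[of 1 0 i UNIV v] assms by simp

text \<open>Consensus never widens the range; hence the bound contains the forcing but no weights.
  The lower bound is applied to the flow and to its reflection.\<close>

lemma deviation_bound:
  assumes "\<And>i. \<bar>y i s - c\<bar> \<le> Y" "s \<le> t" "t \<le> e"
  shows "\<bar>y i t - c\<bar> \<le> Y + M * (e - s)"
proof -
  interpret restricted: balanced_flow y r f b s t M using assms by (intro restrict) auto
  interpret refl: balanced_flow "\<lambda>i t. - y i t" "\<lambda>i t. - r i t" "\<lambda>i t. - f i t" b s t M
    by (rule restricted.reflect)
  have "c - Y \<le> y j s" "- c - Y \<le> - y j s" for j using assms(1)[of j] by (simp_all add: abs_le_iff)
  then have "c - Y - M * (t - s) \<le> y i t" "- c - Y - M * (t - s) \<le> - y i t"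
    using restricted.lower_bound refl.lower_bound by blast+
  moreover have "M * (t - s) \<le> M * (e - s)" using M_nonneg assms by (intro mult_left_mono) auto
  ultimately show ?thesis by (simp add: abs_le_iff)
qed

lemma sum_increment_le:
  "(\<Sum>i\<in>UNIV. y i e) - (\<Sum>i\<in>UNIV. y i s) \<le> real CARD('n) * M * (e - s)"
proof -
  have "((\<lambda>t. \<Sum>i\<in>UNIV. r i t) has_integral (\<Sum>i\<in>UNIV. y i e - y i s)) {s..e}"
    using s_le_e by (intro has_integral_sum int) auto
  moreover have "(\<Sum>i\<in>UNIV. r i t) \<le> real CARD('n) * M" if "t \<in> {s..e}" for t
    using sum_rate_le[of t UNIV 0] that by simp
  ultimately have "(\<Sum>i\<in>UNIV. y i e - y i s) \<le> measure lborel {s..e} *\<^sub>R (real CARD('n) * M)"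
    by (intro has_integral_le[OF _ has_integral_const_real]) auto
  then show ?thesis using s_le_e by (simp add: sum_subtractf mult.commute)
qed

section \<open>Dissipation of the sum of squares\<close>

text \<open>Integrates a differential inequality for the sum of squares. The rate of the sum over
  \<open>A\<close> stands in for the cut weight, because that rate is integrable while the weights
  themselves need not be.\<close>

lemma energy_le:
  assumes pw: "\<And>t. s \<le> t \<Longrightarrow> t \<le> e \<Longrightarrow>
      (\<Sum>i\<in>UNIV. 2 * y i t * r i t) \<le> \<rho> * (\<Sum>k\<in>A. r k t) + \<kappa>"
  shows "(\<Sum>i\<in>UNIV. (y i e)\<^sup>2) \<le> (\<Sum>i\<in>UNIV. (y i s)\<^sup>2)
    - \<rho> * ((\<Sum>k\<in>A. y k s) - (\<Sum>k\<in>A. y k e)) + \<kappa> * (e - s)"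
proof -
  define F where "F t = (\<Sum>i\<in>UNIV. (y i t)\<^sup>2)" for t
  define S where "S t = (\<Sum>i\<in>A. y i t)" for t
  define \<phi> where "\<phi> t = F t - \<rho> * S t - \<kappa> * t" for t
  obtain L where L: "0 \<le> L" "\<And>i t. s \<le> t \<Longrightarrow> t \<le> e \<Longrightarrow> \<bar>r i t\<bar> \<le> L" using rate_bounded by blast
  have "\<phi> e \<le> \<phi> s"
  proof (rule quadratic_increment_le[OF s_le_e, where C = "real CARD('n) * (2 * L * L)"])
    fix t u assume tu: "s \<le> t" "t \<le> u" "u \<le> e"
    \<comment> \<open>The increment of y_i^2 factors as (y_i(u) + y_i(t)) (y_i(u) - y_i(t)). The
      first factor is constant in \<sigma> and can be taken under the integral of
      \<open>r i\<close>; replacing it by 2 y_i(\<sigma>) costs O(u - t) by Lipschitz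
      continuity.\<close>
    have pointwise: "(\<Sum>i\<in>UNIV. (y i u + y i t) * r i \<sigma>) - \<rho> * (\<Sum>k\<in>A. r k \<sigma>)
        \<le> \<kappa> + real CARD('n) * (2 * L * L * (u - t))" if \<sigma>: "\<sigma> \<in> {t..u}" for \<sigma>
    proof -
      have \<sigma>': "s \<le> \<sigma>" "\<sigma> \<le> e" "\<sigma> \<le> u" "t \<le> \<sigma>" using \<sigma> tu by auto
      have "(y i u + y i t) * r i \<sigma> \<le> 2 * y i \<sigma> * r i \<sigma> + 2 * L * L * (u - t)" for i
      proof -
        have "L * (u - \<sigma>) \<le> L * (u - t)" "L * (\<sigma> - t) \<le> L * (u - t)"
          using \<sigma> L(1) by (auto intro!: mult_left_mono)
        moreover have "\<bar>y i u - y i \<sigma>\<bar> \<le> L * (u - \<sigma>)" "\<bar>y i \<sigma> - y i t\<bar> \<le> L * (\<sigma> - t)"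
          using lipschitz[OF L(2)] \<sigma>' tu by auto
        ultimately have "\<bar>y i u + y i t - 2 * y i \<sigma>\<bar> \<le> 2 * L * (u - t)" by linarith
        then have "\<bar>y i u + y i t - 2 * y i \<sigma>\<bar> * \<bar>r i \<sigma>\<bar> \<le> (2 * L * (u - t)) * L"
          using L \<sigma>' tu by (intro mult_mono) auto
        then have "(y i u + y i t - 2 * y i \<sigma>) * r i \<sigma> \<le> (2 * L * (u - t)) * L"
          unfolding abs_mult[symmetric] by linarith
        then show ?thesis by (simp add: algebra_simps)
      qed
      then have "(\<Sum>i\<in>UNIV. (y i u + y i t) * r i \<sigma>)
          \<le> (\<Sum>i\<in>UNIV. 2 * y i \<sigma> * r i \<sigma> + 2 * L * L * (u - t))"
        by (rule sum_mono)
      then show ?thesis using pw[OF \<sigma>'(1,2)] by (simp add: sum.distrib)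
    qed
    have "((\<lambda>\<sigma>. (\<Sum>i\<in>UNIV. (y i u + y i t) * r i \<sigma>) - \<rho> * (\<Sum>k\<in>A. r k \<sigma>)) has_integral
        ((\<Sum>i\<in>UNIV. (y i u + y i t) * (y i u - y i t)) - \<rho> * (\<Sum>k\<in>A. y k u - y k t))) {t..u}"
      by (intro has_integral_diff has_integral_mult_right has_integral_sum int tu) simp_all
    from has_integral_le[OF this has_integral_const_real pointwise]
    have "(\<Sum>i\<in>UNIV. (y i u + y i t) * (y i u - y i t)) - \<rho> * (\<Sum>k\<in>A. y k u - y k t)
        \<le> (u - t) * (\<kappa> + real CARD('n) * (2 * L * L * (u - t)))"
      using tu by simp
    moreover have "(\<Sum>i\<in>UNIV. (y i u + y i t) * (y i u - y i t)) = F u - F t"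
      unfolding F_def sum_subtractf[symmetric]
      by (intro sum.cong) (auto simp: power2_eq_square algebra_simps)
    ultimately show "\<phi> u - \<phi> t \<le> real CARD('n) * (2 * L * L) * (u - t)\<^sup>2"
      by (simp add: \<phi>_def S_def sum_subtractf algebra_simps power2_eq_square)
  qed
  then show ?thesis by (simp add: \<phi>_def F_def S_def algebra_simps)
qed

lemma energy_rate:
  assumes t: "s \<le> t" "t \<le> e" and Y: "\<And>i. \<bar>y i t\<bar> \<le> Y"
  shows "(\<Sum>i\<in>UNIV. 2 * y i t * r i t)
    \<le> - (\<Sum>i\<in>UNIV. \<Sum>j\<in>UNIV. b i j t * (y j t - y i t)\<^sup>2) + 2 * real CARD('n) * M * Y"
proof -
  have "y i t * f i t \<le> Y * M" for i
  proof -
    have "\<bar>y i t\<bar> * \<bar>f i t\<bar> \<le> Y * M"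
      using Y[of i] forcing[OF t, of i] by (intro mult_mono) auto
    then show ?thesis unfolding abs_mult[symmetric] by linarith
  qed
  then have "(\<Sum>i\<in>UNIV. y i t * f i t) \<le> (\<Sum>i\<in>(UNIV::'n set). Y * M)" by (rule sum_mono)
  moreover have "(\<Sum>i\<in>UNIV. 2 * y i t * r i t)
      = (\<Sum>i\<in>UNIV. 2 * y i t * (\<Sum>j\<in>UNIV. b i j t * (y j t - y i t))) + 2 * (\<Sum>i\<in>UNIV. y i t * f i t)"
    by (simp add: rate[OF t] distrib_left sum.distrib sum_distrib_left mult.assoc)
  ultimately show ?thesis
    unfolding balanced_dissipation[OF bal[OF t]] by (simp add: mult.commute mult.left_commute)
qed

text \<open>Uses only the sign of the dissipation, so that it applies when nothing is known about
  gaps. The forcing term remains.\<close>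

lemma energy_growth:
  assumes Y: "\<And>i t. s \<le> t \<Longrightarrow> t \<le> e \<Longrightarrow> \<bar>y i t\<bar> \<le> Y"
  shows "(\<Sum>i\<in>UNIV. (y i e)\<^sup>2) \<le> (\<Sum>i\<in>UNIV. (y i s)\<^sup>2) + 2 * real CARD('n) * M * Y * (e - s)"
proof -
  have "(\<Sum>i\<in>UNIV. 2 * y i t * r i t) \<le> 0 * (\<Sum>k\<in>{}. r k t) + 2 * real CARD('n) * M * Y"
    if t: "s \<le> t" "t \<le> e" for t
  proof -
    have "0 \<le> (\<Sum>i\<in>UNIV. \<Sum>j\<in>UNIV. b i j t * (y j t - y i t)\<^sup>2)"
      using nonneg[OF t] by (intro sum_nonneg mult_nonneg_nonneg) auto
    then show ?thesis using energy_rate[OF t Y[OF t]] by simp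
  qed
  from energy_le[OF this] show ?thesis by simp
qed

text \<open>Squares across the cut dissipate at rate at least \<gamma>^2 w, with w the cut weight.
  The sum over \<open>A\<close> falls at rate at most R w + n M, so its observed fall bounds the
  accumulated w from below; this is where the factor \<gamma>^2 / R comes from.\<close>

lemma energy_drop:
  assumes Y: "\<And>i t. s \<le> t \<Longrightarrow> t \<le> e \<Longrightarrow> \<bar>y i t\<bar> \<le> Y"
    and \<gamma>: "0 \<le> \<gamma>" and R: "0 < R"
    and gap: "\<And>i j t. s \<le> t \<Longrightarrow> t \<le> e \<Longrightarrow> i \<in> A \<Longrightarrow> j \<notin> A \<Longrightarrow> \<gamma> \<le> y i t - y j t"
    and range: "\<And>i j t. s \<le> t \<Longrightarrow> t \<le> e \<Longrightarrow> y i t - y j t \<le> R"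
  shows "(\<Sum>i\<in>UNIV. (y i e)\<^sup>2) \<le> (\<Sum>i\<in>UNIV. (y i s)\<^sup>2)
    - \<gamma>\<^sup>2 / R * ((\<Sum>k\<in>A. y k s) - (\<Sum>k\<in>A. y k e) - real CARD('n) * M * (e - s))
    + 2 * real CARD('n) * M * Y * (e - s)"
proof -
  define \<rho> where "\<rho> = \<gamma>\<^sup>2 / R"
  have \<rho>: "0 \<le> \<rho>" "\<rho> * (R * w) = \<gamma>\<^sup>2 * w" for w using R by (auto simp: \<rho>_def)
  have "(\<Sum>i\<in>UNIV. 2 * y i t * r i t)
      \<le> \<rho> * (\<Sum>k\<in>A. r k t) + (\<rho> * (real CARD('n) * M) + 2 * real CARD('n) * M * Y)"
    if t: "s \<le> t" "t \<le> e" for t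
  proof -
    define w where "w = (\<Sum>i\<in>A. \<Sum>j\<in>-A. b i j t)"
    have "\<gamma>\<^sup>2 * w = (\<Sum>i\<in>A. \<Sum>j\<in>-A. b i j t * \<gamma>\<^sup>2)"
      unfolding w_def sum_distrib_left by (simp add: mult.commute)
    also have "\<dots> \<le> (\<Sum>i\<in>A. \<Sum>j\<in>-A. b i j t * (y j t - y i t)\<^sup>2)"
    proof (intro sum_mono mult_left_mono nonneg[OF t])
      fix i j assume "i \<in> A" "j \<in> -A"
      then have "\<gamma>\<^sup>2 \<le> (y i t - y j t)\<^sup>2" using gap[OF t] \<gamma> by (intro power_mono) auto
      then show "\<gamma>\<^sup>2 \<le> (y j t - y i t)\<^sup>2" by (simp add: power2_commute)
    qed
    also have "\<dots> \<le> (\<Sum>i\<in>A. \<Sum>j\<in>UNIV. b i j t * (y j t - y i t)\<^sup>2)"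
      using nonneg[OF t] by (intro sum_mono sum_mono2) auto
    also have "\<dots> \<le> (\<Sum>i\<in>UNIV. \<Sum>j\<in>UNIV. b i j t * (y j t - y i t)\<^sup>2)"
      using nonneg[OF t] by (intro sum_mono2) (auto intro!: sum_nonneg)
    finally have diss: "\<gamma>\<^sup>2 * w \<le> \<dots>" .
    have "- R * w - real CARD('n) * M \<le> (\<Sum>i\<in>A. r i t)"
      unfolding w_def by (rule sum_rate_ge[OF t range[OF t]])
    from mult_left_mono[OF this \<rho>(1)]
    have "- (\<gamma>\<^sup>2 * w) - \<rho> * (real CARD('n) * M) \<le> \<rho> * (\<Sum>i\<in>A. r i t)"
      using \<rho>(2)[of w] by (simp add: right_diff_distrib)
    then show ?thesis using energy_rate[OF t Y[OF t]] diss by linarith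
  qed
  from energy_le[OF this] show ?thesis by (simp add: \<rho>_def[symmetric] algebra_simps)
qed

text \<open>The graph signal is arbitrary, so \<open>b i j\<close> need not be measurable and the arc condition is one
  on a lower integral; it is compared with the rate of \<open>\<Sum>\<^sub>A y\<^sub>i\<close>, which is integrable.\<close>

lemma sum_drop_from_arc:
  assumes \<gamma>: "0 < \<gamma>" and "i \<in> A" "j \<notin> A"
    and gap: "\<And>i j t. s \<le> t \<Longrightarrow> t \<le> e \<Longrightarrow> i \<in> A \<Longrightarrow> j \<notin> A \<Longrightarrow> \<gamma> \<le> y i t - y j t"
    and arc: "ennreal \<delta> \<le> (\<integral>\<^sup>+ t. ennreal (b i j t) * indicator {s..<e} t \<partial>lborel)"
  shows "\<gamma> * \<delta> - real CARD('n) * M * (e - s) \<le> (\<Sum>k\<in>A. y k s) - (\<Sum>k\<in>A. y k e)"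
proof -
  define g where "g t = (real CARD('n) * M - (\<Sum>k\<in>A. r k t)) / \<gamma>" for t
  define I where "I = ((e - s) * (real CARD('n) * M) - (\<Sum>k\<in>A. y k e - y k s)) / \<gamma>"
  have "((\<lambda>t. real CARD('n) * M - (\<Sum>k\<in>A. r k t)) has_integral
      (measure lborel {s..e} *\<^sub>R (real CARD('n) * M) - (\<Sum>k\<in>A. y k e - y k s))) {s..e}"
    using s_le_e by (intro has_integral_diff has_integral_const_real has_integral_sum int) auto
  then have g_int: "(g has_integral I) {s..e}"
    unfolding g_def I_def using s_le_e has_integral_divide[of _ _ _ \<gamma>] by simp
  have b_le: "b i j t \<le> g t" if t: "s \<le> t" "t \<le> e" for t
  proof -
    define w where "w = (\<Sum>k\<in>A. \<Sum>l\<in>-A. b k l t)"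
    have "b i j t \<le> (\<Sum>l\<in>-A. b i l t)"
      using assms nonneg[OF t] by (intro member_le_sum) auto
    also have "\<dots> \<le> w" unfolding w_def
      using assms nonneg[OF t] by (intro member_le_sum[of i A "\<lambda>k. \<Sum>l\<in>-A. b k l t"]) (auto intro: sum_nonneg)
    finally have "\<gamma> * b i j t \<le> \<gamma> * w" using \<gamma> by simp
    moreover have "(\<Sum>k\<in>A. r k t) \<le> - \<gamma> * w + real CARD('n) * M"
      unfolding w_def by (rule sum_rate_le[OF t gap[OF t]])
    ultimately have "b i j t * \<gamma> \<le> real CARD('n) * M - (\<Sum>k\<in>A. r k t)"
      by (simp add: mult.commute)
    then show ?thesis using \<gamma> by (simp add: g_def pos_le_divide_eq)
  qed
  have g_nonneg: "0 \<le> g t" if "t \<in> {s..e}" for t using b_le[of t] nonneg[of t i j] that by simp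
  have I: "0 \<le> I" using g_int g_nonneg by (rule has_integral_nonneg)
  have "(\<integral>\<^sup>+ t. ennreal (b i j t) * indicator {s..<e} t \<partial>lborel)
      \<le> (\<integral>\<^sup>+ t. ennreal (g t) * indicator {s..e} t \<partial>lborel)"
    by (intro nn_integral_mono) (auto simp: indicator_def b_le intro: ennreal_leI)
  also have "\<dots> = ennreal I" by (rule nn_integral_has_integral_lebesgue'[OF g_nonneg g_int])
  finally have "\<delta> \<le> I" using order_trans[OF arc] ennreal_le_iff[OF I] by blast
  then show ?thesis using \<gamma> by (simp add: I_def field_simps sum_subtractf)
qed

section \<open>Contraction of the variance over one window\<close>

text \<open>If the gap stays above \<open>g / 2\<close>, the arc across the cut acts until
  \<open>e\<close> and \<open>sum_drop_from_arc\<close> applies. Otherwise \<open>t0\<close> is the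
  first time the gap reaches \<open>g / 2\<close>; the two groups have then approached each other by
  \<open>g / 2\<close>, which by \<open>upper_group_lower_bound\<close>, used for both of them, is
  impossible unless the sum over \<open>A\<close> has dropped.\<close>

lemma exists_sum_drop:
  assumes g: "0 < g" and ne: "A \<noteq> {}"
    and gap: "\<And>i j. i \<in> A \<Longrightarrow> j \<notin> A \<Longrightarrow> g \<le> y i s - y j s"
    and range: "\<And>i j t. s \<le> t \<Longrightarrow> t \<le> e \<Longrightarrow> y i t - y j t \<le> 2 * real CARD('n) * g"
    and small: "56 * (real CARD('n))\<^sup>2 * (M * (e - s)) \<le> g"
    and "i0 \<in> A" "j0 \<notin> A"
    and arc: "ennreal \<delta> \<le> (\<integral>\<^sup>+ t. ennreal (b i0 j0 t) * indicator {s..<e} t \<partial>lborel)"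
  shows "\<exists>t0. s \<le> t0 \<and> t0 \<le> e \<and> (\<forall>t i j. s \<le> t \<longrightarrow> t \<le> t0 \<longrightarrow> i \<in> A \<longrightarrow> j \<notin> A \<longrightarrow> g / 2 \<le> y i t - y j t)
    \<and> min (g / (32 * real CARD('n))) (g / 2 * \<delta> - real CARD('n) * (M * (e - s)))
      \<le> (\<Sum>k\<in>A. y k s) - (\<Sum>k\<in>A. y k t0)"
proof (cases "\<forall>t i j. s \<le> t \<longrightarrow> t \<le> e \<longrightarrow> i \<in> A \<longrightarrow> j \<notin> A \<longrightarrow> g / 2 \<le> y i t - y j t")
  case True
  then have "g / 2 * \<delta> - real CARD('n) * M * (e - s) \<le> (\<Sum>k\<in>A. y k s) - (\<Sum>k\<in>A. y k e)"
    using g assms by (intro sum_drop_from_arc[of "g / 2" i0 A j0 \<delta>]) auto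
  then show ?thesis using True s_le_e by (intro exI[of _ e]) (auto simp: mult.assoc)
next
  case False
  define n where "n = real CARD('n)"
  have n: "1 \<le> n" by (simp add: n_def Suc_leI)
  \<comment> \<open>The times at which some pair across the cut is within \<open>g / 2\<close>. It
    is compact, so a first such time exists.\<close>
  define X where "X = (\<Union>i\<in>A. \<Union>j\<in>-A. {t \<in> {s..e}. y i t - y j t \<le> g / 2})"
  have "closed {t \<in> {s..e}. y i t - y j t \<le> g / 2}" for i j
    by (intro continuous_on_closed_Collect_le continuous_on_diff continuous continuous_on_const) simp
  then have "closed X" unfolding X_def by (intro closed_UN) auto
  moreover have "{s..e} \<inter> X = X" by (auto simp: X_def)
  ultimately have "compact X" using compact_Int_closed[OF compact_Icc, of X s e] by simp
  moreover have "X \<noteq> {}" using False by (force simp: X_def)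
  ultimately have "\<exists>t0\<in>X. \<forall>t\<in>X. t0 \<le> t" by (rule compact_attains_inf)
  then obtain t0 where t0: "t0 \<in> X" "\<And>t. t \<in> X \<Longrightarrow> t0 \<le> t" by auto
  obtain p q where pq: "p \<in> A" "q \<notin> A" "y p t0 - y q t0 \<le> g / 2" and t0_in: "s \<le> t0" "t0 \<le> e"
    using t0(1) by (auto simp: X_def)
  have before: "g / 2 \<le> y i t - y j t" if "s \<le> t" "t < t0" "i \<in> A" "j \<notin> A" for t i j
  proof (rule ccontr)
    assume "\<not> g / 2 \<le> y i t - y j t"
    then have "t \<in> X" unfolding X_def using that t0_in by (intro UN_I[of i] UN_I[of j]) auto
    then show False using t0(2)[of t] that by simp
  qed
  have "s \<noteq> t0" using pq gap[of p q] g by auto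
  then have "s < t0" using t0_in by simp
  \<comment> \<open>By continuity the gap is still at least \<open>g / 2\<close> at the closing time
    itself, so the estimates hold on the closed interval up to \<open>t0\<close>.\<close>
  have at: "g / 2 \<le> y i t0 - y j t0" if ij: "i \<in> A" "j \<notin> A" for i j
  proof (rule continuous_ge_on_closure[of "{s..<t0}" "\<lambda>t. y i t - y j t"])
    have "continuous_on {s..t0} (y k)" for k
      by (rule continuous_on_subset[OF continuous]) (use t0_in in auto)
    then show "continuous_on (closure {s..<t0}) (\<lambda>t. y i t - y j t)"
      using \<open>s < t0\<close> by (auto intro!: continuous_intros)
  qed (use \<open>s < t0\<close> before ij in auto)
  have gap': "g / 2 \<le> y i t - y j t" if "s \<le> t" "t \<le> t0" "i \<in> A" "j \<notin> A" for t i j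
    using before[of t i j] at[of i j] that by (cases "t = t0") auto
  interpret restricted: balanced_flow y r f b s t0 M using t0_in by (intro restrict) auto
  interpret refl: balanced_flow "\<lambda>i t. - y i t" "\<lambda>i t. - r i t" "\<lambda>i t. - f i t" b s t0 M
    by (rule restricted.reflect)
  define v where "v = Min ((\<lambda>i. y i s) ` A)"
  define \<mu> where "\<mu> = M * (t0 - s)"
  define \<Delta> where "\<Delta> = (\<Sum>k\<in>A. y k s) - (\<Sum>k\<in>A. y k t0)"
  have v: "v \<le> y i s" if "i \<in> A" for i using that by (simp add: v_def)
  have "v \<in> (\<lambda>i. y i s) ` A" unfolding v_def by (rule Min_in) (use ne in auto)
  then have v': "g - v \<le> - y j s" if "j \<notin> A" for j using gap that by fastforce
  have ratio: "2 * n * g / (g / 2) = 4 * n" using g by simp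
  have \<mu>0: "0 \<le> \<mu>" using M_nonneg t0_in by (simp add: \<mu>_def)
  have "v - 2 * n * g / (g / 2) * (\<Delta> + n * M * (t0 - s)) - M * (t0 - s) \<le> y p t0"
    unfolding \<Delta>_def n_def
    by (rule restricted.upper_group_lower_bound) (use g gap' range v t0_in pq in auto)
  then have 1: "v - 4 * n * (\<Delta> + n * \<mu>) - \<mu> \<le> y p t0" unfolding ratio by (simp add: \<mu>_def mult.assoc)
  \<comment> \<open>The lower group, seen as an upper group of the reflected flow. The rise of its
    sum is converted to \<Delta> below, because the total sum moves only through the
    forcing.\<close>
  have "(g - v) - 2 * n * g / (g / 2) * ((\<Sum>i\<in>-A. - y i s) - (\<Sum>i\<in>-A. - y i t0) + n * M * (t0 - s))
      - M * (t0 - s) \<le> - y q t0"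
    unfolding n_def
    by (rule refl.upper_group_lower_bound) (use g gap' range v' t0_in pq in auto)
  then have 2: "(g - v) - 4 * n * ((\<Sum>i\<in>-A. y i t0) - (\<Sum>i\<in>-A. y i s) + n * \<mu>) - \<mu> \<le> - y q t0"
    unfolding ratio by (simp add: \<mu>_def mult.assoc sum_negf)
  have "(\<Sum>i\<in>-A. y i t0) - (\<Sum>i\<in>-A. y i s) \<le> \<Delta> + n * \<mu>"
    using restricted.sum_increment_le by (simp add: sum_UNIV_split[of _ A] \<Delta>_def n_def \<mu>_def mult.assoc)
  then have "4 * n * ((\<Sum>i\<in>-A. y i t0) - (\<Sum>i\<in>-A. y i s) + n * \<mu>) \<le> 4 * n * (\<Delta> + 2 * (n * \<mu>))"
    using n by (intro mult_left_mono) (linarith, simp)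
  then have "g / 2 \<le> 8 * n * \<Delta> + 12 * (n\<^sup>2 * \<mu>) + 2 * \<mu>"
    using 1 2 pq(3) by (simp add: algebra_simps power2_eq_square)
  moreover have "\<mu> \<le> n\<^sup>2 * \<mu>" using mult_right_mono[of 1 "n\<^sup>2" \<mu>] \<mu>0 n by simp
  moreover have "n\<^sup>2 * \<mu> \<le> n\<^sup>2 * (M * (e - s))"
    unfolding \<mu>_def using M_nonneg t0_in by (intro mult_left_mono) auto
  \<comment> \<open>The forcing contributes at most 12 + 2 = 14 times n^2 \<mu>, and
    \<open>small\<close> has the factor 56 = 4 * 14, which makes this at most
    \<open>g / 4\<close>.\<close>
  ultimately have "g / 4 \<le> 8 * n * \<Delta>" using small unfolding n_def by linarith
  then have "g / (32 * n) \<le> \<Delta>" using n by (simp add: field_simps)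
  then show ?thesis using gap' t0_in by (intro exI[of _ t0]) (auto simp: n_def \<Delta>_def)
qed

lemma spread_bounds:
  assumes "\<And>i. y p s \<le> y i s" "\<And>i. y i s \<le> y q s" "c = (\<Sum>i\<in>UNIV. y i s) / real CARD('n)"
  shows "\<bar>y i s - c\<bar> \<le> y q s - y p s"
proof -
  have "(\<Sum>i\<in>(UNIV::'n set). y p s) \<le> (\<Sum>i\<in>UNIV. y i s)" "(\<Sum>i\<in>UNIV. y i s) \<le> (\<Sum>i\<in>(UNIV::'n set). y q s)"
    using assms(1,2) by (intro sum_mono; simp)+
  then have "y p s \<le> c" "c \<le> y q s" by (simp_all add: assms(3) field_simps)
  then show ?thesis using assms(1,2)[of i] by (simp add: abs_le_iff)
qed

text \<open>Both alternatives of \<open>exists_sum_drop\<close>, with \<open>g = R / n\<close>, give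
  a fall of at least \<eta> R: a closing gap gives \<open>g / (32 * n)\<close>, and an acting arc
  gives g \<delta> / 2, of which one half is reserved for the forcing. The centre \<open>c\<close>
  stays frozen at the initial mean.\<close>

lemma variance_drop:
  assumes \<delta>: "0 < \<delta>"
    and pq: "\<And>i. y p s \<le> y i s" "\<And>i. y i s \<le> y q s"
    and c: "c = (\<Sum>i\<in>UNIV. y i s) / real CARD('n)"
    and n: "n = real CARD('n)"
    and \<eta>: "\<eta> = min (1 / (32 * n\<^sup>2)) (\<delta> / (4 * n))"
    and arcs: "\<And>A. A \<noteq> {} \<Longrightarrow> A \<noteq> UNIV \<Longrightarrow> \<exists>i\<in>A. \<exists>j\<in>-A.
        ennreal \<delta> \<le> (\<integral>\<^sup>+ t. ennreal (b i j t) * indicator {s..<e} t \<partial>lborel)"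
    and R: "R = y q s - y p s"
    and small: "M * (e - s) < \<eta> / (56 * n ^ 3) * R"
  shows "(\<Sum>i\<in>UNIV. (y i e - c)\<^sup>2) \<le> (\<Sum>i\<in>UNIV. (y i s - c)\<^sup>2)
    - \<eta> / (16 * n\<^sup>2) * R\<^sup>2 + 4 * n * R * (M * (e - s))"
proof -
  define \<mu> where "\<mu> = M * (e - s)"
  have n1: "1 \<le> n" by (simp add: n Suc_leI)
  have \<mu>0: "0 \<le> \<mu>" using M_nonneg s_le_e by (simp add: \<mu>_def)
  have \<eta>0: "0 < \<eta>" using \<eta> n1 \<delta> by simp
  have \<eta>1: "\<eta> \<le> 1 / (32 * n\<^sup>2)" "\<eta> \<le> \<delta> / (4 * n)" using \<eta> by auto
  have npow: "1 \<le> n\<^sup>2" "n \<le> n\<^sup>2" using n1 by (auto simp: power_increasing[of 1 2 n, simplified])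
  have sm: "56 * n ^ 3 * \<mu> < \<eta> * R"
    using small n1 by (simp add: \<mu>_def field_simps)
  \<comment> \<open>The strict inequality in \<open>small\<close> excludes a vanishing spread, for
    which no cut with a positive gap would exist.\<close>
  have "0 < \<eta> * R" using sm \<mu>0 n1 by (smt (verit) mult_nonneg_nonneg zero_le_power)
  then have R0: "0 < R" using \<eta>0 by (simp add: zero_less_mult_iff)
  have \<eta>le1: "\<eta> \<le> 1"
    using \<eta>1(1) npow(1) by (smt (verit) divide_le_eq_1)
  have n2\<mu>: "56 * (n * (n\<^sup>2 * \<mu>)) < \<eta> * R" using sm by (simp add: power3_eq_cube power2_eq_square mult.assoc)
  have a: "n\<^sup>2 * \<mu> \<le> n * (n\<^sup>2 * \<mu>)" using mult_right_mono[of 1 n "n\<^sup>2 * \<mu>"] n1 \<mu>0 by simp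
  have a2: "n * \<mu> \<le> n\<^sup>2 * \<mu>" using npow(2) \<mu>0 by (rule mult_right_mono)
  have a3: "\<mu> \<le> n * \<mu>" using mult_right_mono[of 1 n \<mu>] n1 \<mu>0 by simp
  have \<eta>R: "\<eta> * R \<le> R" using mult_right_mono[OF \<eta>le1, of R] R0 by simp
  define g where "g = R / n"
  have g: "0 < g" "n * g = R" using R0 n1 by (auto simp: g_def)
  have "y p s < y q s" using R0 R by simp
  from exists_gap_cut[OF this] obtain A where A: "A \<noteq> {}" "A \<noteq> UNIV"
    "\<And>i j. i \<in> A \<Longrightarrow> j \<notin> A \<Longrightarrow> g \<le> y i s - y j s"
    unfolding g_def n R by blast
  obtain i0 j0 where ij: "i0 \<in> A" "j0 \<notin> A"
    "ennreal \<delta> \<le> (\<integral>\<^sup>+ t. ennreal (b i0 j0 t) * indicator {s..<e} t \<partial>lborel)"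
    using arcs[OF A(1,2)] by auto
  have dev: "\<bar>y i t - c\<bar> \<le> 2 * R" if "s \<le> t" "t \<le> e" for i t
  proof -
    have "\<bar>y i t - c\<bar> \<le> R + M * (e - s)"
      using that spread_bounds[OF pq c] by (intro deviation_bound) (auto simp: R)
    then show ?thesis using n2\<mu> a a2 a3 \<eta>R \<mu>0 R0 unfolding \<mu>_def[symmetric] by linarith
  qed
  have range: "y i t - y j t \<le> 2 * R" if "s \<le> t" "t \<le> e" for i j t
  proof -
    \<comment> \<open>Deviations are measured from the midpoint instead of the mean: starting from R
      / 2 on each side, the range grows only to R + 2 \<mu>, which is below 2 R.\<close>
    define mid where "mid = (y p s + y q s) / 2"
    have "\<bar>y k s - mid\<bar> \<le> R / 2" for k
      unfolding abs_le_iff mid_def R using pq[of k] by (auto simp: field_simps)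
    then have "\<bar>y k t - mid\<bar> \<le> R / 2 + M * (e - s)" for k
      using that by (intro deviation_bound) auto
    from this[of i] this[of j] show ?thesis
      using n2\<mu> a a2 a3 \<eta>R \<mu>0 R0 unfolding \<mu>_def[symmetric] by linarith
  qed
  have small': "56 * (n\<^sup>2 * \<mu>) \<le> g"
  proof -
    have "n * (56 * (n\<^sup>2 * \<mu>)) \<le> n * g" using n2\<mu> \<eta>R unfolding g by simp
    then show ?thesis using n1 by simp
  qed
  have "y i t - y j t \<le> 2 * real CARD('n) * g" if "s \<le> t" "t \<le> e" for i j t
    using range[OF that, of i j] unfolding n[symmetric] mult.assoc g(2) .
  moreover have "56 * (real CARD('n))\<^sup>2 * (M * (e - s)) \<le> g"
    using small' by (simp add: n \<mu>_def)
  ultimately obtain t0 where t0: "s \<le> t0" "t0 \<le> e"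
    "\<And>t i j. s \<le> t \<Longrightarrow> t \<le> t0 \<Longrightarrow> i \<in> A \<Longrightarrow> j \<notin> A \<Longrightarrow> g / 2 \<le> y i t - y j t"
    "min (g / (32 * n)) (g / 2 * \<delta> - n * \<mu>) \<le> (\<Sum>k\<in>A. y k s) - (\<Sum>k\<in>A. y k t0)"
    using exists_sum_drop[OF g(1) A(1,3) _ _ ij] unfolding \<mu>_def n by blast
  define \<Delta> where "\<Delta> = (\<Sum>k\<in>A. y k s) - (\<Sum>k\<in>A. y k t0)"
  have "\<eta> * R \<le> g / (32 * n)"
  proof -
    have "\<eta> * R \<le> 1 / (32 * n\<^sup>2) * R" using \<eta>1(1) R0 by (intro mult_right_mono) auto
    also have "\<dots> = g / (32 * n)" using n1 by (simp add: g_def power2_eq_square)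
    finally show ?thesis .
  qed
  moreover have "\<eta> * R \<le> g / 2 * \<delta> - n * \<mu>"
  proof -
    have "\<eta> * R \<le> \<delta> / (4 * n) * R" using \<eta>1(2) R0 by (intro mult_right_mono) auto
    also have "\<dots> = g / 4 * \<delta>" by (simp add: g_def mult.commute)
    finally have "\<eta> * R \<le> g / 4 * \<delta>" .
    moreover have "n * \<mu> \<le> \<eta> * R" using n2\<mu> a a2 \<mu>0 n1 by (smt (verit) mult_nonneg_nonneg zero_le_power)
    ultimately show ?thesis by simp
  qed
  ultimately have drop: "\<eta> * R \<le> \<Delta>" using t0(4) unfolding \<Delta>_def by linarith
  interpret first: balanced_flow "\<lambda>i t. y i t - c" r f b s t0 M
    by (rule balanced_flow.shift, rule restrict) (use t0 in auto)
  \<comment> \<open>After \<open>t0\<close> the gap may close completely; there only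
    \<open>energy_growth\<close> is used, and the drop gained up to \<open>t0\<close> is
    kept.\<close>
  interpret rest: balanced_flow "\<lambda>i t. y i t - c" r f b t0 e M
    by (rule balanced_flow.shift, rule restrict) (use t0 in auto)
  have coeff: "(g / 2)\<^sup>2 / (2 * R) = R / (8 * n\<^sup>2)"
    using R0 n1 by (simp add: g_def power2_eq_square field_simps)
  have "(\<Sum>i\<in>UNIV. (y i t0 - c)\<^sup>2) \<le> (\<Sum>i\<in>UNIV. (y i s - c)\<^sup>2)
      - (g / 2)\<^sup>2 / (2 * R) * ((\<Sum>k\<in>A. y k s - c) - (\<Sum>k\<in>A. y k t0 - c) - real CARD('n) * M * (t0 - s))
      + 2 * real CARD('n) * M * (2 * R) * (t0 - s)"
    by (rule first.energy_drop) (use dev range t0 R0 g in auto)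
  note this[unfolded coeff]
  moreover have "R / (8 * n\<^sup>2) * (\<eta> * R / 2)
      \<le> R / (8 * n\<^sup>2) * ((\<Sum>k\<in>A. y k s - c) - (\<Sum>k\<in>A. y k t0 - c) - real CARD('n) * M * (t0 - s))"
  proof (rule mult_left_mono)
    have "n * (M * (t0 - s)) \<le> n * \<mu>"
      unfolding \<mu>_def using n1 M_nonneg t0 by (intro mult_left_mono) auto
    moreover have "2 * (n * \<mu>) \<le> \<eta> * R" using n2\<mu> a a2 \<mu>0 n1 by (smt (verit) mult_nonneg_nonneg zero_le_power)
    ultimately show "\<eta> * R / 2 \<le> (\<Sum>k\<in>A. y k s - c) - (\<Sum>k\<in>A. y k t0 - c) - real CARD('n) * M * (t0 - s)"
      using drop unfolding \<Delta>_def sum_subtractf n[symmetric] mult.assoc by linarith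
  qed (use R0 in simp)
  moreover have "R / (8 * n\<^sup>2) * (\<eta> * R / 2) = \<eta> / (16 * n\<^sup>2) * R\<^sup>2"
    by (simp add: power2_eq_square)
  moreover have "(\<Sum>i\<in>UNIV. (y i e - c)\<^sup>2) \<le> (\<Sum>i\<in>UNIV. (y i t0 - c)\<^sup>2)
      + 2 * real CARD('n) * M * (2 * R) * (e - t0)"
    by (rule rest.energy_growth) (use dev t0 in auto)
  moreover have "2 * real CARD('n) * M * (2 * R) * (t0 - s) + 2 * real CARD('n) * M * (2 * R) * (e - t0)
      = 4 * n * R * (M * (e - s))"
    by (simp add: n algebra_simps)
  ultimately show ?thesis by linarith
qed

end

text \<open>Permits a window estimate about the mean of its left end to be restated about the mean
  of its right end.\<close>

lemma sum_squares_mean_le: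
  fixes x :: "'n::finite \<Rightarrow> real"
  shows "(\<Sum>i\<in>UNIV. (x i - (\<Sum>i\<in>UNIV. x i) / real CARD('n))\<^sup>2) \<le> (\<Sum>i\<in>UNIV. (x i - c)\<^sup>2)"
proof -
  define n where "n = real CARD('n)"
  define \<mu> where "\<mu> = (\<Sum>i\<in>UNIV. x i) / n"
  have n: "n > 0" by (simp add: n_def)
  have sum: "(\<Sum>i\<in>UNIV. x i) = n * \<mu>" using n by (simp add: \<mu>_def)
  have "(\<Sum>i\<in>UNIV. (x i - c)\<^sup>2) = (\<Sum>i\<in>UNIV. (x i - \<mu>)\<^sup>2 + 2 * (\<mu> - c) * x i + (c\<^sup>2 - \<mu>\<^sup>2))"
    by (intro sum.cong refl) (simp add: power2_eq_square algebra_simps)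
  also have "\<dots> = (\<Sum>i\<in>UNIV. (x i - \<mu>)\<^sup>2) + 2 * (\<mu> - c) * (n * \<mu>) + n * (c\<^sup>2 - \<mu>\<^sup>2)"
    by (simp only: sum.distrib sum_distrib_left[symmetric] sum) (simp add: n_def)
  also have "\<dots> = (\<Sum>i\<in>UNIV. (x i - \<mu>)\<^sup>2) + n * (\<mu> - c)\<^sup>2"
    by (simp add: power2_eq_square algebra_simps)
  finally show ?thesis using n unfolding \<mu>_def n_def by simp
qed

text \<open>The constants are obtained before the flow, which expresses that they depend on the
  number of nodes and \<delta> alone. If the forcing is small relative to the spread,
  \<open>variance_drop\<close> applies. Otherwise the spread is itself O(M (e - s)), and so is every
  deviation at the end of the window.\<close>

lemma variance_contraction:
  assumes \<delta>: "0 < \<delta>"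
  obtains C \<theta> where "0 < C" "\<theta> < 1" "0 < \<theta>"
    "\<And>(y::'n::finite \<Rightarrow> real \<Rightarrow> real) r f b s e M. balanced_flow y r f b s e M \<Longrightarrow>
      (\<And>A. A \<noteq> {} \<Longrightarrow> A \<noteq> UNIV \<Longrightarrow> \<exists>i\<in>A. \<exists>j\<in>-A.
        ennreal \<delta> \<le> (\<integral>\<^sup>+ t. ennreal (b i j t) * indicator {s..<e} t \<partial>lborel)) \<Longrightarrow>
      (\<Sum>i\<in>UNIV. (y i e - (\<Sum>i\<in>UNIV. y i e) / real CARD('n))\<^sup>2)
        \<le> (1 - \<theta>) * (\<Sum>i\<in>UNIV. (y i s - (\<Sum>i\<in>UNIV. y i s) / real CARD('n))\<^sup>2) + C * (M * (e - s))\<^sup>2"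
proof -
  define n where "n = real CARD('n)"
  define \<eta> where "\<eta> = min (1 / (32 * n\<^sup>2)) (\<delta> / (4 * n))"
  define \<kappa> where "\<kappa> = \<eta> / (56 * n ^ 3)"
  \<comment> \<open>Half of the drop in \<open>variance_drop\<close> absorbs the mixed term; the
    other half, \<eta> R^2 / (32 n^2), is compared with the variance, which is at most n
    R^2.\<close>
  define \<theta> where "\<theta> = \<eta> / (32 * n ^ 3)"
  \<comment> \<open>The first summand comes from completing the square when the forcing is small,
    the second from \<open>n\<close> deviations of size (1 / \<kappa> + 1) \<mu> when it is
    large.\<close>
  define C where "C = 128 * n ^ 4 / \<eta> + n * (1 / \<kappa> + 1)\<^sup>2"
  have n1: "1 \<le> n" by (simp add: n_def Suc_leI)
  have \<eta>0: "0 < \<eta>" using \<delta> n1 by (simp add: \<eta>_def)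
  have \<kappa>0: "0 < \<kappa>" using \<eta>0 n1 by (simp add: \<kappa>_def)
  have \<theta>0: "0 < \<theta>" using \<eta>0 n1 by (simp add: \<theta>_def)
  have "1 \<le> n\<^sup>2" "1 \<le> n ^ 3" using n1 by auto
  then have "1 / (32 * n\<^sup>2) \<le> 1" by (simp add: divide_le_eq)
  then have "\<eta> < 32 * n ^ 3" using \<open>1 \<le> n ^ 3\<close> unfolding \<eta>_def by linarith
  then have \<theta>1: "\<theta> < 1" using n1 by (simp add: \<theta>_def)
  have C1: "0 \<le> 128 * n ^ 4 / \<eta>" "0 \<le> n * (1 / \<kappa> + 1)\<^sup>2" using \<eta>0 n1 by auto
  have "0 < 128 * n ^ 4 / \<eta>" using \<eta>0 n1 by simp
  then have C0: "0 < C" using C1 by (simp add: C_def)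
  have "(\<Sum>i\<in>UNIV. (y i e - (\<Sum>i\<in>UNIV. y i e) / real CARD('n))\<^sup>2)
        \<le> (1 - \<theta>) * (\<Sum>i\<in>UNIV. (y i s - (\<Sum>i\<in>UNIV. y i s) / real CARD('n))\<^sup>2) + C * (M * (e - s))\<^sup>2"
    if flow: "balanced_flow y r f b s e M"
      and arcs: "\<And>A. A \<noteq> {} \<Longrightarrow> A \<noteq> UNIV \<Longrightarrow> \<exists>i\<in>A. \<exists>j\<in>-A.
        ennreal \<delta> \<le> (\<integral>\<^sup>+ t. ennreal (b i j t) * indicator {s..<e} t \<partial>lborel)"
    for y r f :: "'n \<Rightarrow> real \<Rightarrow> real" and b s e M
  proof -
    interpret balanced_flow y r f b s e M by (rule flow)
    define \<mu> where "\<mu> = M * (e - s)"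
    define c where "c = (\<Sum>i\<in>UNIV. y i s) / real CARD('n)"
    define D where "D = (\<Sum>i\<in>UNIV. (y i s - c)\<^sup>2)"
    have \<mu>0: "0 \<le> \<mu>" using M_nonneg s_le_e by (simp add: \<mu>_def)
    have "Min (range (\<lambda>i. y i s)) \<in> range (\<lambda>i. y i s)" "Max (range (\<lambda>i. y i s)) \<in> range (\<lambda>i. y i s)"
      by (rule Min_in Max_in; simp)+
    then obtain p q where pq': "y p s = Min (range (\<lambda>i. y i s))" "y q s = Max (range (\<lambda>i. y i s))"
      by (metis (no_types, lifting) imageE)
    have pq: "y p s \<le> y i s" "y i s \<le> y q s" for i unfolding pq' by auto
    define R where "R = y q s - y p s"
    have R0: "0 \<le> R" using pq by (simp add: R_def)
    have dev: "\<bar>y i s - c\<bar> \<le> R" for i unfolding R_def by (rule spread_bounds[OF pq c_def])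
    have "(y i s - c)\<^sup>2 \<le> R\<^sup>2" for i using dev[of i] R0 abs_le_square_iff[of "y i s - c" R] by simp
    then have "D \<le> (\<Sum>i\<in>(UNIV::'n set). R\<^sup>2)" unfolding D_def by (intro sum_mono) simp
    then have DR: "D \<le> n * R\<^sup>2" by (simp add: n_def)
    have D0: "0 \<le> D" unfolding D_def by (intro sum_nonneg) simp
    have "(\<Sum>i\<in>UNIV. (y i e - c)\<^sup>2) \<le> (1 - \<theta>) * D + C * \<mu>\<^sup>2"
    proof (cases "\<mu> < \<kappa> * R")
      case True
      have "(\<Sum>i\<in>UNIV. (y i e - c)\<^sup>2) \<le> D - \<eta> / (16 * n\<^sup>2) * R\<^sup>2 + 4 * n * R * \<mu>"
        unfolding D_def \<mu>_def
        by (rule variance_drop[OF \<delta> pq c_def n_def \<eta>_def arcs R_def])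
          (use True in \<open>simp_all add: \<mu>_def \<kappa>_def\<close>)
      moreover have "4 * n * R * \<mu> \<le> \<eta> / (32 * n\<^sup>2) * R\<^sup>2 + 128 * n ^ 4 / \<eta> * \<mu>\<^sup>2"
      proof -
        have "0 \<le> \<eta> / (32 * n\<^sup>2) * (R - 64 * n ^ 3 / \<eta> * \<mu>)\<^sup>2" using \<eta>0 by simp
        also have "\<dots> = \<eta> / (32 * n\<^sup>2) * R\<^sup>2 - 4 * n * R * \<mu> + 128 * n ^ 4 / \<eta> * \<mu>\<^sup>2"
          using \<eta>0 n1 by (simp add: power2_eq_square power3_eq_cube power4_eq_xxxx field_simps)
        finally show ?thesis by simp
      qed
      moreover have "\<theta> * D \<le> \<eta> / (32 * n\<^sup>2) * R\<^sup>2"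
      proof -
        have "\<theta> * D \<le> \<theta> * (n * R\<^sup>2)" using DR \<theta>0 by simp
        also have "\<dots> = \<eta> / (32 * n\<^sup>2) * R\<^sup>2"
          using n1 by (simp add: \<theta>_def power2_eq_square power3_eq_cube)
        finally show ?thesis .
      qed
      moreover have "\<eta> / (16 * n\<^sup>2) * R\<^sup>2 = 2 * (\<eta> / (32 * n\<^sup>2) * R\<^sup>2)" by simp
      moreover have "128 * n ^ 4 / \<eta> * \<mu>\<^sup>2 \<le> C * \<mu>\<^sup>2" using C1 by (intro mult_right_mono) (auto simp: C_def)
      ultimately show ?thesis by (simp add: left_diff_distrib)
    next
      case False
      then have R\<mu>: "R \<le> 1 / \<kappa> * \<mu>" using \<kappa>0 by (simp add: field_simps)
      have "(y i e - c)\<^sup>2 \<le> ((1 / \<kappa> + 1) * \<mu>)\<^sup>2" for i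
      proof -
        have "\<bar>y i e - c\<bar> \<le> R + M * (e - s)" using s_le_e dev by (intro deviation_bound) auto
        also have "\<dots> \<le> (1 / \<kappa> + 1) * \<mu>" using R\<mu> by (simp add: \<mu>_def distrib_right)
        finally show ?thesis by (intro abs_le_square_iff[THEN iffD1]) simp
      qed
      then have "(\<Sum>i\<in>UNIV. (y i e - c)\<^sup>2) \<le> (\<Sum>i\<in>(UNIV::'n set). ((1 / \<kappa> + 1) * \<mu>)\<^sup>2)"
        by (rule sum_mono)
      also have "\<dots> = n * (1 / \<kappa> + 1)\<^sup>2 * \<mu>\<^sup>2" by (simp add: n_def power_mult_distrib)
      also have "\<dots> \<le> C * \<mu>\<^sup>2" using C1 by (intro mult_right_mono) (auto simp: C_def)
      also have "\<dots> \<le> (1 - \<theta>) * D + C * \<mu>\<^sup>2" using \<theta>1 D0 by simp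
      finally show ?thesis .
    qed
    then show ?thesis
      using sum_squares_mean_le[of "\<lambda>i. y i e" c] unfolding D_def \<mu>_def c_def by linarith
  qed
  then show ?thesis by (rule that[OF C0 \<theta>1 \<theta>0])
qed

section \<open>The vector-valued flow\<close>

lemma has_integral_interval_diff:
  fixes f :: "real \<Rightarrow> 'a::banach"
  assumes "(f has_integral A) {c..t}" "(f has_integral B) {c..u}" "c \<le> t" "t \<le> u"
  shows "(f has_integral (B - A)) {t..u}"
proof -
  have "f integrable_on {c..u}" using assms(2) by auto
  then have "f integrable_on {t..u}"
    by (rule integrable_subinterval_real) (use assms in auto)
  moreover have "integral {c..t} f + integral {t..u} f = integral {c..u} f"
    by (rule Henstock_Kurzweil_Integration.integral_combine) (use assms in auto)
  ultimately show ?thesis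
    using integral_unique[OF assms(1)] integral_unique[OF assms(2)]
    by (metis add_diff_cancel_left' integrable_integral)
qed

lemma affine_recursion_bound:
  fixes u :: "nat \<Rightarrow> real"
  assumes "\<And>k. u (Suc k) \<le> (1 - q) * u k + b" "0 < q" "q \<le> 1" "0 \<le> b"
  shows "u k \<le> (1 - q) ^ k * u 0 + b / q"
proof (induction k)
  case 0
  show ?case using assms by simp
next
  case (Suc k)
  have "u (Suc k) \<le> (1 - q) * ((1 - q) ^ k * u 0 + b / q) + b"
    using assms(1)[of k] mult_left_mono[OF Suc, of "1 - q"] assms(3) by linarith
  also have "\<dots> = (1 - q) ^ Suc k * u 0 + b / q"
    using assms(2) by (simp add: field_simps)
  finally show ?case .
qed

text \<open>Young's inequality with a free parameter. It is used with q of order T, so that the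
  factor 1 + q spends only part of the contraction in \<open>gram_step\<close>.\<close>

lemma norm_add_squared_le:
  fixes u v :: "'a::real_inner"
  assumes "0 < q"
  shows "(norm (u + v))\<^sup>2 \<le> (1 + q) * (norm u)\<^sup>2 + (1 + 1 / q) * (norm v)\<^sup>2"
proof -
  have "(norm (u + v))\<^sup>2 \<le> (norm u + norm v)\<^sup>2" by (intro power_mono norm_triangle_ineq) simp
  also have "\<dots> = (1 + q) * (norm u)\<^sup>2 + (1 + 1 / q) * (norm v)\<^sup>2 - (q * norm u - norm v)\<^sup>2 / q"
    using assms by (simp add: power2_eq_square field_simps)
  also have "\<dots> \<le> (1 + q) * (norm u)\<^sup>2 + (1 + 1 / q) * (norm v)\<^sup>2" using assms by simp
  finally show ?thesis .
qed

lemma norm_le_card_mult: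
  fixes v :: "real^'m"
  assumes "\<And>l. \<bar>v $ l\<bar> \<le> S"
  shows "norm v \<le> real CARD('m) * S"
proof -
  have "norm v \<le> (\<Sum>l\<in>UNIV. \<bar>v $ l\<bar>)" by (rule norm_le_l1_cart)
  also have "\<dots> \<le> (\<Sum>l\<in>(UNIV::'m set). S)" by (rule sum_mono) (rule assms)
  finally show ?thesis by simp
qed

lemma norm_squared_eq_sum:
  fixes v :: "real^'m"
  shows "(norm v)\<^sup>2 = (\<Sum>l\<in>UNIV. (v $ l)\<^sup>2)"
  unfolding power2_norm_eq_inner inner_vec_def by (simp add: power2_eq_square)

locale projection_consensus =
  fixes H :: "real^'m^'n" and z :: "real^'n" and K :: real
    and E :: "real \<Rightarrow> ('n \<times> 'n) set" and a :: "'n \<Rightarrow> 'n \<Rightarrow> real \<Rightarrow> real"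
    and x0 :: "'n \<Rightarrow> real^'m" and x :: "'n \<Rightarrow> real \<Rightarrow> real^'m"
  assumes unit: "\<And>i. norm (H $ i) = 1"
    and normal: "(\<Sum>i\<in>UNIV. z $ i *\<^sub>R H $ i) = 0"
    and K: "1 \<le> K"
    and weights: "admissible_weights a"
    and balanced: "balanced E a"
    and traj: "is_trajectory H z K E a x0 x"
begin

section \<open>Reduction to scalar flows, coordinate by coordinate\<close>

text \<open>The gain is absorbed into the weights. With \<open>1 \<le> K\<close> every \<delta>-arc
  keeps at least its weight, and a large gain costs nothing since
  \<open>variance_contraction\<close> does not involve the size of the weights.\<close>

definition arc_weight :: "'n \<Rightarrow> 'n \<Rightarrow> real \<Rightarrow> real" where
  "arc_weight i j t = K * (a i j t * (if (j, i) \<in> E t then 1 else 0))"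

text \<open>The projection part of the flow in coordinate \<open>l\<close>. It couples the
  coordinates; for the disagreement it is treated as a bounded disturbance.\<close>

definition force :: "'m \<Rightarrow> 'n \<Rightarrow> real \<Rightarrow> real" where
  "force l i t = (z $ i - H $ i \<bullet> x i t) * H $ i $ l"

definition mean :: "real \<Rightarrow> real^'m" where
  "mean t = (1 / real CARD('n)) *\<^sub>R (\<Sum>i\<in>UNIV. x i t)"

definition disagreement :: "real \<Rightarrow> real" where
  "disagreement t = (\<Sum>i\<in>UNIV. (norm (x i t - mean t))\<^sup>2)"

text \<open>H^T H / N applied to \<open>v\<close>. Its negative is the drift of the mean when all
  nodes agree.\<close>

definition gram :: "real^'m \<Rightarrow> real^'m" where
  "gram v = (1 / real CARD('n)) *\<^sub>R (\<Sum>i\<in>UNIV. (H $ i \<bullet> v) *\<^sub>R H $ i)"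

lemma integral:
  assumes "0 \<le> t" "t \<le> u"
  shows "(flow_rhs H z K E a x i has_integral (x i u - x i t)) {t..u}"
  using has_integral_interval_diff[of "flow_rhs H z K E a x i" "x i t - x0 i" 0 t "x i u - x0 i" u]
    traj assms by (simp add: is_trajectory_def)

lemma continuous: "0 \<le> s \<Longrightarrow> continuous_on {s..e} (x i)"
proof (cases "s \<le> e")
  case True
  assume s: "0 \<le> s"
  have "flow_rhs H z K E a x i integrable_on {s..e}" using integral[OF s True] by auto
  then have "continuous_on {s..e} (\<lambda>t. x i s + integral {s..t} (flow_rhs H z K E a x i))"
    by (intro continuous_intros indefinite_integral_continuous_1)
  moreover have "x i s + integral {s..t} (flow_rhs H z K E a x i) = x i t" if "t \<in> {s..e}" for t
    using integral_unique[OF integral[of s t i]] that s by auto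
  ultimately show ?thesis by (rule continuous_on_eq)
qed simp

lemma sum_nbrs:
  fixes g :: "'n \<Rightarrow> 'a::real_vector"
  shows "(\<Sum>j\<in>nbrs E t i. g j) = (\<Sum>j\<in>UNIV. (if (j, i) \<in> E t then 1 else 0) *\<^sub>R g j)"
proof -
  have "(\<Sum>j\<in>UNIV. (if (j, i) \<in> E t then 1 else 0) *\<^sub>R g j) = (\<Sum>j\<in>UNIV. if (j, i) \<in> E t then g j else 0)"
    by (intro sum.cong) auto
  then show ?thesis by (simp add: nbrs_def sum.inter_filter[symmetric])
qed

lemma flow_rhs_component:
  "flow_rhs H z K E a x i t $ l
    = (\<Sum>j\<in>UNIV. arc_weight i j t * (x j t $ l - x i t $ l)) + force l i t"
  by (simp add: flow_rhs_def sum_nbrs arc_weight_def force_def proj_def sum_distrib_left algebra_simps)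

lemma arc_weight_nonneg: "0 \<le> t \<Longrightarrow> 0 \<le> arc_weight i j t"
  using weights K by (auto simp: arc_weight_def admissible_weights_def intro!: mult_nonneg_nonneg less_imp_le)

lemma arc_weight_balanced:
  assumes "0 \<le> t"
  shows "(\<Sum>j\<in>UNIV. arc_weight i j t) = (\<Sum>j\<in>UNIV. arc_weight j i t)"
proof -
  have "(\<Sum>j\<in>nbrs E t i. a i j t) = (\<Sum>j\<in>{j. i \<in> nbrs E t j}. a j i t)"
    using balanced assms by (simp add: balanced_def)
  also have "(\<Sum>j\<in>{j. i \<in> nbrs E t j}. a j i t) = (\<Sum>j\<in>UNIV. if (i, j) \<in> E t then a j i t else 0)"
    by (simp add: nbrs_def sum.inter_filter[symmetric])
  also have "\<dots> = (\<Sum>j\<in>UNIV. a j i t * (if (i, j) \<in> E t then 1 else 0))"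
    by (intro sum.cong) auto
  finally show ?thesis
    by (simp add: arc_weight_def sum_distrib_left[symmetric] sum_nbrs mult.commute)
qed

lemma component_flow:
  assumes "0 \<le> s" "s \<le> e" and M: "\<And>i t. s \<le> t \<Longrightarrow> t \<le> e \<Longrightarrow> \<bar>force l i t\<bar> \<le> M"
  shows "balanced_flow (\<lambda>i t. x i t $ l) (\<lambda>i t. flow_rhs H z K E a x i t $ l) (force l) arc_weight s e M"
proof unfold_locales
  fix i t u assume "s \<le> t" "t \<le> u" "u \<le> e"
  then have "(flow_rhs H z K E a x i has_integral (x i u - x i t)) {t..u}"
    using assms by (intro integral) auto
  from has_integral_linear[OF this bounded_linear_vec_nth[of l]]
  show "((\<lambda>t. flow_rhs H z K E a x i t $ l) has_integral (x i u $ l - x i t $ l)) {t..u}"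
    by (simp add: o_def)
next
  obtain astar where as: "astar > 0" "\<And>i j t. t \<ge> 0 \<Longrightarrow> a i j t \<le> astar"
    using weights by (auto simp: admissible_weights_def)
  have "arc_weight i j t \<le> K * astar" if "s \<le> t" for i j t
    unfolding arc_weight_def using as K assms that by (intro mult_left_mono) (auto simp: less_imp_le)
  then show "\<exists>\<beta>. \<forall>i j t. s \<le> t \<longrightarrow> t \<le> e \<longrightarrow> arc_weight i j t \<le> \<beta>" by blast
qed (use assms in \<open>auto intro: arc_weight_nonneg arc_weight_balanced flow_rhs_component\<close>)

lemma force_bound:
  assumes "\<bar>z $ i\<bar> \<le> Z" "norm (x i t) \<le> X"
  shows "\<bar>force l i t\<bar> \<le> Z + X"
proof -
  have "\<bar>H $ i \<bullet> x i t\<bar> \<le> norm (x i t)" using Cauchy_Schwarz_ineq2[of "H $ i" "x i t"] unit by simp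
  then have "\<bar>z $ i - H $ i \<bullet> x i t\<bar> \<le> Z + X" using assms by linarith
  moreover have "\<bar>H $ i $ l\<bar> \<le> 1" using component_le_norm_cart[of "H $ i" l] unit by simp
  ultimately have "\<bar>z $ i - H $ i \<bullet> x i t\<bar> * \<bar>H $ i $ l\<bar> \<le> (Z + X) * 1"
    by (intro mult_mono) auto
  then show ?thesis by (simp add: force_def abs_mult)
qed

text \<open>A bound \<open>S\<close> for the components on the window improves itself to \<open>B + T (Z + m S)\<close>,
  so for \<open>m T \<le> 1/2\<close> the least bound is controlled by the value at the left end.\<close>

lemma window_bound:
  assumes s: "0 \<le> s" and T: "0 < T" "real CARD('m) * T \<le> 1 / 2"
    and B: "\<And>i l. \<bar>x i s $ l\<bar> \<le> B" and Z: "\<And>i. \<bar>z $ i\<bar> \<le> Z"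
    and t: "s \<le> t" "t \<le> s + T"
  shows "\<bar>x i t $ l\<bar> \<le> 2 * B + 2 * T * Z"
    and "\<bar>force l i t\<bar> \<le> 2 * real CARD('m) * (B + Z)"
proof -
  define m where "m = real CARD('m)"
  \<comment> \<open>All nodes, components and times of the window enter one supremum, because the
    force in one component involves all components.\<close>
  define X where "X = {\<bar>x i t $ l\<bar> | i l t. t \<in> {s..s+T}}"
  define S where "S = Sup X"
  have m1: "1 \<le> m" by (simp add: m_def Suc_leI)
  have Z0: "0 \<le> Z" using Z by (meson abs_ge_zero order_trans)
  have "\<exists>Y. \<forall>t\<in>{s..s+T}. norm (x i t) \<le> Y" for i
    using compact_imp_bounded[OF compact_continuous_image[OF continuous[OF s, of "s + T" i] compact_Icc]]
    by (auto simp: bounded_iff)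
  then obtain Y where Y: "\<And>i t. t \<in> {s..s+T} \<Longrightarrow> norm (x i t) \<le> Y i" by metis
  have "\<bar>x i t $ l\<bar> \<le> Max (range Y)" if "t \<in> {s..s+T}" for i l t
    using component_le_norm_cart[of "x i t" l] Y[OF that, of i] Max_ge[of "range Y" "Y i"]
    by (auto intro: order_trans)
  then have bdd: "bdd_above X" unfolding X_def by (intro bdd_aboveI[of _ "Max (range Y)"]) auto
  have S: "\<bar>x i t $ l\<bar> \<le> S" if "t \<in> {s..s+T}" for i l t
    unfolding S_def by (rule cSup_upper[OF _ bdd]) (use that in \<open>auto simp: X_def\<close>)
  have force_S: "\<bar>force l i t\<bar> \<le> Z + m * S" if "s \<le> t" "t \<le> s + T" for l i t
    unfolding m_def using S that by (intro force_bound Z norm_le_card_mult) auto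
  have improved: "\<bar>x i t $ l\<bar> \<le> B + (Z + m * S) * T" if "t \<in> {s..s+T}" for i l t
  proof -
    interpret balanced_flow "\<lambda>i t. x i t $ l" "\<lambda>i t. flow_rhs H z K E a x i t $ l" "force l" arc_weight
        s "s + T" "Z + m * S"
      using s T force_S by (intro component_flow) auto
    show ?thesis using deviation_bound[of 0 B t i] B that by simp
  qed
  have "S \<le> B + (Z + m * S) * T"
    unfolding S_def
  proof (rule cSup_least)
    show "X \<noteq> {}" using T by (auto simp: X_def intro!: exI[of _ s])
  qed (use improved S_def in \<open>auto simp: X_def\<close>)
  moreover have "m * T * S \<le> 1 / 2 * S"
    using T S[of s] by (intro mult_right_mono) (auto simp: m_def intro: order_trans[OF abs_ge_zero])
  ultimately have SB: "S \<le> 2 * B + 2 * T * Z" by (simp add: algebra_simps)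
  then show "\<bar>x i t $ l\<bar> \<le> 2 * B + 2 * T * Z" using S[of t i l] t by simp
  have "m * S \<le> m * (2 * B) + m * T * (2 * Z)"
    using mult_left_mono[OF SB, of m] m1 by (simp add: algebra_simps)
  also have "m * T * (2 * Z) \<le> 1 / 2 * (2 * Z)"
    using T Z0 by (intro mult_right_mono) (auto simp: m_def)
  finally have "Z + m * S \<le> 2 * m * B + 2 * Z" by simp
  also have "\<dots> \<le> 2 * m * (B + Z)" using mult_right_mono[OF m1 Z0] by (simp add: distrib_left)
  finally show "\<bar>force l i t\<bar> \<le> 2 * real CARD('m) * (B + Z)"
    using force_S[OF t, of l i] by (simp add: m_def)
qed

lemma mean_component: "mean t $ l = (\<Sum>i\<in>UNIV. x i t $ l) / real CARD('n)"
  by (simp add: mean_def)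

lemma disagreement_eq:
  "disagreement t = (\<Sum>l\<in>UNIV. \<Sum>i\<in>UNIV. (x i t $ l - (\<Sum>i\<in>UNIV. x i t $ l) / real CARD('n))\<^sup>2)"
  unfolding disagreement_def norm_squared_eq_sum
  by (subst sum.swap) (simp add: mean_component)

lemma disagreement_nonneg: "0 \<le> disagreement t"
  unfolding disagreement_def by (intro sum_nonneg) simp

lemma norm_deviation_le: "norm (x i t - mean t) \<le> sqrt (disagreement t)"
  unfolding disagreement_def
  by (rule real_le_rsqrt) (rule member_le_sum[of i UNIV "\<lambda>i. (norm (x i t - mean t))\<^sup>2"], auto)

lemma component_le: "\<bar>x i t $ l\<bar> \<le> norm (mean t) + sqrt (disagreement t)"
proof -
  have "\<bar>x i t $ l\<bar> \<le> norm (x i t)" by (rule component_le_norm_cart)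
  also have "\<dots> \<le> norm (mean t) + norm (x i t - mean t)" by (metis add.commute norm_triangle_sub)
  finally show ?thesis using norm_deviation_le[of i t] by linarith
qed

section \<open>Motion of the mean\<close>

lemma norm_gram_le:
  assumes "\<And>i. norm (v i) \<le> G"
  shows "norm ((1 / real CARD('n)) *\<^sub>R (\<Sum>i\<in>UNIV. (H $ i \<bullet> v i) *\<^sub>R H $ i)) \<le> G"
proof -
  have "norm ((H $ i \<bullet> v i) *\<^sub>R H $ i) \<le> G" for i
    using Cauchy_Schwarz_ineq2[of "H $ i" "v i"] unit assms[of i] by simp
  then have "norm (\<Sum>i\<in>UNIV. (H $ i \<bullet> v i) *\<^sub>R H $ i) \<le> (\<Sum>i\<in>(UNIV::'n set). G)"
    by (rule sum_norm_le)
  then show ?thesis by (simp add: field_simps)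
qed

text \<open>Expanding the square gives the factor 1 - 2 \<alpha> T + T^2, since \<open>gram\<close>
  does not increase norms; \<open>T \<le> \<alpha>\<close> turns T^2 into at most \<alpha>
  T.\<close>

lemma gram_step:
  assumes coercive: "\<And>v. \<alpha> * (norm v)\<^sup>2 \<le> v \<bullet> gram v" and T: "0 \<le> T" "T \<le> \<alpha>"
  shows "(norm (v - T *\<^sub>R gram v))\<^sup>2 \<le> (1 - \<alpha> * T) * (norm v)\<^sup>2"
proof -
  have "norm (gram v) \<le> norm v" unfolding gram_def by (rule norm_gram_le) simp
  then have "T\<^sup>2 * (norm (gram v))\<^sup>2 \<le> \<alpha> * T * (norm v)\<^sup>2"
    using T by (intro mult_mono power_mono) (auto simp: power2_eq_square mult_right_mono)
  moreover have "T * (\<alpha> * (norm v)\<^sup>2) \<le> T * (v \<bullet> gram v)"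
    using coercive[of v] T by (intro mult_left_mono) auto
  moreover have "(norm (v - T *\<^sub>R gram v))\<^sup>2 = (norm v)\<^sup>2 - 2 * (T * (v \<bullet> gram v)) + T\<^sup>2 * (norm (gram v))\<^sup>2"
    unfolding power2_norm_eq_inner
    by (simp add: inner_diff_left inner_diff_right inner_commute[of "gram v" v] power2_eq_square algebra_simps)
  ultimately show ?thesis by (simp add: algebra_simps)
qed

lemma sum_flow_rhs:
  assumes "0 \<le> t"
  shows "(\<Sum>i\<in>UNIV. flow_rhs H z K E a x i t) = - (\<Sum>i\<in>UNIV. (H $ i \<bullet> x i t) *\<^sub>R H $ i)"
proof -
  have "(\<Sum>i\<in>UNIV. flow_rhs H z K E a x i t) = (\<Sum>i\<in>UNIV. (z $ i - H $ i \<bullet> x i t) *\<^sub>R H $ i)"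
  proof (rule vec_eq_iff[THEN iffD2], rule allI)
    fix l
    \<comment> \<open>The cut for \<open>A = UNIV\<close> is empty, so consensus does not move the
      mean.\<close>
    have "(\<Sum>i\<in>UNIV. \<Sum>j\<in>UNIV. arc_weight i j t * (x j t $ l - x i t $ l)) = 0"
      using cut_flux[of "\<lambda>i j. arc_weight i j t" "\<lambda>i. x i t $ l" UNIV] arc_weight_balanced[OF assms] by simp
    then show "(\<Sum>i\<in>UNIV. flow_rhs H z K E a x i t) $ l
        = (\<Sum>i\<in>UNIV. (z $ i - H $ i \<bullet> x i t) *\<^sub>R H $ i) $ l"
      by (simp add: flow_rhs_component sum.distrib force_def)
  qed
  also have "\<dots> = - (\<Sum>i\<in>UNIV. (H $ i \<bullet> x i t) *\<^sub>R H $ i)"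
    using normal by (simp add: scaleR_left_diff_distrib sum_subtractf)
  finally show ?thesis .
qed

text \<open>The mean follows an explicit Euler step. Its true rate averages the vectors - (h_i .
  x_i) h_i; replacing each x_i by the initial mean changes the rate by at most \<open>G\<close>,
  because the rows are unit vectors.\<close>

lemma mean_step:
  assumes "0 \<le> s" "0 \<le> T" "0 \<le> G"
    and G: "\<And>i t. s \<le> t \<Longrightarrow> t \<le> s + T \<Longrightarrow> norm (x i t - mean s) \<le> G"
  shows "norm (mean (s + T) - (mean s - T *\<^sub>R gram (mean s))) \<le> G * T"
proof -
  let ?n = "real CARD('n)"
  have "((\<lambda>t. (1 / ?n) *\<^sub>R (\<Sum>i\<in>UNIV. flow_rhs H z K E a x i t) + gram (mean s)) has_integral
      ((1 / ?n) *\<^sub>R (\<Sum>i\<in>UNIV. x i (s + T) - x i s) + measure lborel {s..s+T} *\<^sub>R gram (mean s))) {s..s+T}"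
    using assms by (intro has_integral_add has_integral_cmul has_integral_sum integral has_integral_const_real) auto
  moreover have "norm ((1 / ?n) *\<^sub>R (\<Sum>i\<in>UNIV. flow_rhs H z K E a x i t) + gram (mean s)) \<le> G"
    if "t \<in> {s..s+T} - {}" for t
  proof -
    have "(1 / ?n) *\<^sub>R (\<Sum>i\<in>UNIV. flow_rhs H z K E a x i t) + gram (mean s)
        = - ((1 / ?n) *\<^sub>R (\<Sum>i\<in>UNIV. (H $ i \<bullet> (x i t - mean s)) *\<^sub>R H $ i))"
      using that assms
      by (simp add: sum_flow_rhs gram_def inner_diff_right scaleR_left_diff_distrib sum_subtractf scaleR_right_diff_distrib)
    then show ?thesis using norm_gram_le[of "\<lambda>i. x i t - mean s" G] G that by simp
  qed
  ultimately have "norm ((1 / ?n) *\<^sub>R (\<Sum>i\<in>UNIV. x i (s + T) - x i s) + measure lborel {s..s+T} *\<^sub>R gram (mean s))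
      \<le> G * measure lborel {s..s+T}"
    by (rule has_integral_bound_real[OF assms(3) finite.emptyI])
  moreover have "(1 / ?n) *\<^sub>R (\<Sum>i\<in>UNIV. x i (s + T) - x i s) + measure lborel {s..s+T} *\<^sub>R gram (mean s)
      = mean (s + T) - (mean s - T *\<^sub>R gram (mean s))"
    using assms by (simp add: mean_def sum_subtractf scaleR_right_diff_distrib)
  ultimately show ?thesis using assms(2) by (metis add_diff_cancel_left' measure_lborel_Icc le_add_same_cancel1)
qed

lemma window_arcs:
  assumes ujsc: "UJSC E a \<delta> T" and s: "0 \<le> s" and A: "A \<noteq> {}" "A \<noteq> UNIV"
  shows "\<exists>i\<in>A. \<exists>j\<in>-A.
    ennreal \<delta> \<le> (\<integral>\<^sup>+ t. ennreal (arc_weight i j t) * indicator {s..<s+T} t \<partial>lborel)"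
proof -
  have "strongly_connected {(j, i). delta_arc E a \<delta> s (s + T) j i}"
    using ujsc s by (simp add: UJSC_def)
  from strongly_connected_cut[OF this A]
  obtain i j where ij: "i \<in> A" "j \<in> -A" "delta_arc E a \<delta> s (s + T) j i" by auto
  have "ennreal \<delta> \<le> (\<integral>\<^sup>+ t. ennreal (a i j t * (if (j, i) \<in> E t then 1 else 0)) * indicator {s..<s+T} t \<partial>lborel)"
    using ij(3) by (simp add: delta_arc_def)
  also have "\<dots> \<le> (\<integral>\<^sup>+ t. ennreal (arc_weight i j t) * indicator {s..<s+T} t \<partial>lborel)"
  proof (rule nn_integral_mono)
    fix t
    show "ennreal (a i j t * (if (j, i) \<in> E t then 1 else 0)) * indicator {s..<s+T} t
        \<le> ennreal (arc_weight i j t) * indicator {s..<s+T} t"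
    proof (cases "t \<in> {s..<s+T}")
      case True
      then have "0 \<le> a i j t * (if (j, i) \<in> E t then 1 else 0)"
        using weights s by (auto simp: admissible_weights_def less_imp_le)
      from mult_right_mono[OF K this] show ?thesis
        using True by (simp add: arc_weight_def ennreal_leI)
    qed simp
  qed
  finally show ?thesis using ij by blast
qed

section \<open>The energy over one window and in the limit\<close>

definition energy :: "real \<Rightarrow> real" where
  "energy t = (norm (mean t))\<^sup>2 + disagreement t"

text \<open>The force is bounded by the state at the left end, so its square is at most 12 m^2 Q
  with \<open>Q\<close> = P + D + Z^2. The errors are of two kinds. Multiples of T^2 (P + D) are
  absorbed by \<open>T * C' \<le> \<alpha> / 4\<close>. The mean additionally suffers an error of
  order T D, larger than T^2, and this is paid out of the fixed fraction \<theta> that the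
  disagreement loses. Only the Z^2 T^2 term remains.\<close>

lemma window_energy_step:
  assumes s: "0 \<le> s" and T: "0 < T" "real CARD('m) * T \<le> 1 / 2" "T \<le> \<alpha>" and \<alpha>: "0 < \<alpha>" "\<alpha> \<le> 1"
    and coercive: "\<And>v. \<alpha> * (norm v)\<^sup>2 \<le> v \<bullet> gram v"
    and Z: "\<And>i. \<bar>z $ i\<bar> \<le> Z"
    and \<theta>: "\<theta> < 1" and C: "0 < C"
    and contraction: "\<And>l M. balanced_flow (\<lambda>i t. x i t $ l) (\<lambda>i t. flow_rhs H z K E a x i t $ l)
        (force l) arc_weight s (s + T) M \<Longrightarrow>
      (\<Sum>i\<in>UNIV. (x i (s + T) $ l - (\<Sum>i\<in>UNIV. x i (s + T) $ l) / real CARD('n))\<^sup>2)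
        \<le> (1 - \<theta>) * (\<Sum>i\<in>UNIV. (x i s $ l - (\<Sum>i\<in>UNIV. x i s $ l) / real CARD('n))\<^sup>2) + C * (M * T)\<^sup>2"
    and C': "C' = 12 * real CARD('m) ^ 3 * C + 72 * real CARD('m) ^ 4 / \<alpha>"
    and T': "T * (C' + \<alpha> / 2) \<le> \<theta>" "T * C' \<le> \<alpha> / 4"
  shows "energy (s + T) \<le> (1 - \<alpha> * T / 4) * energy s + C' * Z\<^sup>2 * T\<^sup>2"
proof -
  define m where "m = real CARD('m)"
  define P where "P = (norm (mean s))\<^sup>2"
  define D where "D = disagreement s"
  define B where "B = norm (mean s) + sqrt D"
  define M where "M = 2 * m * (B + Z)"
  define Q where "Q = P + D + Z\<^sup>2"
  define G where "G = m * (sqrt D + M * T)"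
  have m1: "1 \<le> m" by (simp add: m_def Suc_leI)
  have D0: "0 \<le> D" by (simp add: D_def disagreement_nonneg)
  have P0: "0 \<le> P" by (simp add: P_def)
  have Q0: "0 \<le> Q" using P0 D0 by (simp add: Q_def)
  have Z0: "0 \<le> Z" using Z by (meson abs_ge_zero order_trans)
  have B0: "0 \<le> B" using D0 by (simp add: B_def)
  have M0: "0 \<le> M" using m1 B0 Z0 by (simp add: M_def)
  have G0: "0 \<le> G" using m1 M0 D0 T by (simp add: G_def)
  have T1: "T \<le> 1" using T \<alpha> by simp
  have B: "\<bar>x i s $ l\<bar> \<le> B" for i l unfolding B_def D_def by (rule component_le)
  have flow: "balanced_flow (\<lambda>i t. x i t $ l) (\<lambda>i t. flow_rhs H z K E a x i t $ l) (force l) arc_weight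
      s (s + T) M" for l
    using s T window_bound(2)[OF s T(1,2) B Z] by (intro component_flow) (auto simp: M_def m_def)
  have "(B + Z)\<^sup>2 \<le> 3 * Q"
  proof -
    \<comment> \<open>The inequality (a + b + c)^2 \<le> 3 (a^2 + b^2 + c^2), written as an identity
      with squares on the right.\<close>
    have "3 * Q - (B + Z)\<^sup>2 = (norm (mean s) - sqrt D)\<^sup>2 + (norm (mean s) - Z)\<^sup>2 + (sqrt D - Z)\<^sup>2
        + 3 * (D - (sqrt D)\<^sup>2)"
      unfolding Q_def B_def P_def by (simp only: power2_eq_square) (simp add: algebra_simps)
    then show ?thesis using D0 by (smt (verit) real_sqrt_pow2 zero_le_power2)
  qed
  then have M2: "M\<^sup>2 \<le> 12 * m\<^sup>2 * Q"
    unfolding M_def power_mult_distrib using mult_left_mono[of "(B + Z)\<^sup>2" "3 * Q" "4 * m\<^sup>2"] by simp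
  have D': "disagreement (s + T) \<le> (1 - \<theta>) * D + 12 * m ^ 3 * C * T\<^sup>2 * Q"
  proof -
    have "disagreement (s + T) \<le> (\<Sum>l\<in>(UNIV::'m set).
        (1 - \<theta>) * (\<Sum>i\<in>UNIV. (x i s $ l - (\<Sum>i\<in>UNIV. x i s $ l) / real CARD('n))\<^sup>2) + C * (M * T)\<^sup>2)"
      unfolding disagreement_eq by (intro sum_mono contraction flow)
    also have "\<dots> = (1 - \<theta>) * D + m * (C * (M * T)\<^sup>2)"
      by (simp add: sum.distrib sum_distrib_left[symmetric] D_def disagreement_eq m_def)
    also have "m * (C * (M * T)\<^sup>2) = m * C * T\<^sup>2 * M\<^sup>2" by (simp add: power_mult_distrib)
    also have "\<dots> \<le> m * C * T\<^sup>2 * (12 * m\<^sup>2 * Q)"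
      using M2 m1 C by (intro mult_left_mono) auto
    also have "\<dots> = 12 * m ^ 3 * C * T\<^sup>2 * Q" by (simp add: power3_eq_cube power2_eq_square)
    finally show ?thesis by simp
  qed
  have dev: "norm (x i t - mean s) \<le> G" if "s \<le> t" "t \<le> s + T" for i t
    unfolding G_def m_def
  proof (rule norm_le_card_mult)
    fix l
    have "\<bar>x j s $ l - mean s $ l\<bar> \<le> sqrt D" for j
      using component_le_norm_cart[of "x j s - mean s" l] norm_deviation_le[of j s] by (simp add: D_def)
    then have "\<bar>x i t $ l - mean s $ l\<bar> \<le> sqrt D + M * (s + T - s)"
      by (rule balanced_flow.deviation_bound[OF flow _ that])
    then show "\<bar>(x i t - mean s) $ l\<bar> \<le> sqrt D + M * T" by simp
  qed
  define u where "u = mean s - T *\<^sub>R gram (mean s)"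
  define w where "w = mean (s + T) - u"
  have w: "(norm w)\<^sup>2 \<le> T\<^sup>2 * G\<^sup>2"
  proof -
    have "norm w \<le> G * T"
      unfolding w_def u_def by (rule mean_step[OF s _ G0 dev]) (use T in auto)
    then have "(norm w)\<^sup>2 \<le> (G * T)\<^sup>2" by (intro power_mono) auto
    then show ?thesis by (simp add: power_mult_distrib mult.commute)
  qed
  have G2: "G\<^sup>2 \<le> 2 * m\<^sup>2 * (D + T\<^sup>2 * (12 * m\<^sup>2 * Q))"
  proof -
    define W where "W = T\<^sup>2 * (12 * m\<^sup>2 * Q)"
    have MT: "(M * T)\<^sup>2 \<le> W" unfolding W_def
      using mult_left_mono[OF M2, of "T\<^sup>2"] by (simp only: power_mult_distrib mult.commute[of "M\<^sup>2"] zero_le_power2)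
    have "(sqrt D + M * T)\<^sup>2 \<le> 2 * ((sqrt D)\<^sup>2 + (M * T)\<^sup>2)"
      using sum_squares_bound[of "sqrt D" "M * T"] by (simp add: power2_sum)
    also have "\<dots> \<le> 2 * (D + W)"
      using D0 MT by (intro mult_left_mono add_mono) auto
    finally have "(sqrt D + M * T)\<^sup>2 \<le> 2 * (D + W)" .
    then have "m\<^sup>2 * (sqrt D + M * T)\<^sup>2 \<le> m\<^sup>2 * (2 * (D + W))"
      by (intro mult_left_mono) auto
    then show ?thesis
      unfolding W_def G_def by (simp only: power_mult_distrib mult.assoc mult.left_commute[of "m\<^sup>2" 2])
  qed
  have \<alpha>T: "0 < \<alpha> * T" "\<alpha> * T \<le> 1" using \<alpha> T T1 mult_mono[of \<alpha> 1 T 1] by auto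
  have P': "(norm (mean (s + T)))\<^sup>2 \<le> (1 - \<alpha> * T / 2) * P + 72 * m ^ 4 / \<alpha> * (T * (D + T\<^sup>2 * Q))"
  proof -
    \<comment> \<open>The parameter \<alpha> T / 2 gives up half of the contraction 1 - \<alpha> T.
      The error then carries a factor of order 1 / (\<alpha> T), but the squared error is at most
      T^2 G^2, so one power of T survives.\<close>
    have "(norm (u + w))\<^sup>2 \<le> (1 + \<alpha> * T / 2) * (norm u)\<^sup>2 + (1 + 1 / (\<alpha> * T / 2)) * (norm w)\<^sup>2"
      by (rule norm_add_squared_le) (use \<alpha>T in simp)
    moreover have "(1 + \<alpha> * T / 2) * (norm u)\<^sup>2 \<le> (1 - \<alpha> * T / 2) * P"
    proof -
      have "(1 + \<alpha> * T / 2) * (norm u)\<^sup>2 \<le> (1 + \<alpha> * T / 2) * ((1 - \<alpha> * T) * P)"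
        unfolding u_def P_def using \<alpha>T T by (intro mult_left_mono gram_step coercive) auto
      also have "\<dots> = (1 - \<alpha> * T / 2) * P - (\<alpha> * T)\<^sup>2 / 2 * P"
        by (simp add: power2_eq_square field_simps)
      also have "\<dots> \<le> (1 - \<alpha> * T / 2) * P" using P0 by simp
      finally show ?thesis .
    qed
    moreover have "(1 + 1 / (\<alpha> * T / 2)) * (norm w)\<^sup>2 \<le> 72 * m ^ 4 / \<alpha> * (T * (D + T\<^sup>2 * Q))"
    proof -
      have "1 + 1 / (\<alpha> * T / 2) \<le> 3 / (\<alpha> * T)" using \<alpha>T by (simp add: field_simps)
      then have "(1 + 1 / (\<alpha> * T / 2)) * (norm w)\<^sup>2 \<le> 3 / (\<alpha> * T) * (T\<^sup>2 * G\<^sup>2)"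
        using w \<alpha>T by (intro mult_mono) auto
      also have "\<dots> = 3 / \<alpha> * (T * G\<^sup>2)" using T \<alpha> by (simp add: power2_eq_square)
      also have "\<dots> \<le> 3 / \<alpha> * (T * (2 * m\<^sup>2 * (D + T\<^sup>2 * (12 * m\<^sup>2 * Q))))"
        using G2 T \<alpha> by (intro mult_left_mono) auto
      also have "\<dots> \<le> 3 / \<alpha> * (T * (2 * m\<^sup>2 * (12 * m\<^sup>2 * (D + T\<^sup>2 * Q))))"
      proof -
        have "1 \<le> m\<^sup>2" using m1 by (rule one_le_power)
        then have "1 \<le> 12 * m\<^sup>2" by simp
        from mult_right_mono[OF this D0] have "D + T\<^sup>2 * (12 * m\<^sup>2 * Q) \<le> 12 * m\<^sup>2 * (D + T\<^sup>2 * Q)"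
          by (simp add: algebra_simps)
        then show ?thesis using T \<alpha> by (intro mult_left_mono) auto
      qed
      also have "\<dots> = 72 * m ^ 4 / \<alpha> * (T * (D + T\<^sup>2 * Q))"
        by (simp add: power2_eq_square power4_eq_xxxx)
      finally show ?thesis .
    qed
    ultimately show ?thesis by (simp add: w_def)
  qed
  define C2 where "C2 = 12 * m ^ 3 * C"
  define C3 where "C3 = 72 * m ^ 4 / \<alpha>"
  have C23: "0 \<le> C2" "0 \<le> C3" "C' = C2 + C3" using m1 C \<alpha> by (auto simp: C2_def C3_def C' m_def)
  have "energy (s + T) \<le> (1 - \<alpha> * T / 2) * P + C3 * (T * (D + T\<^sup>2 * Q)) + ((1 - \<theta>) * D + C2 * T\<^sup>2 * Q)"
    using P' D' by (simp add: energy_def C2_def C3_def)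
  moreover have "C3 * (T * (D + T\<^sup>2 * Q)) \<le> C' * T * D + C3 * T\<^sup>2 * Q"
  proof -
    have "T ^ 3 \<le> T\<^sup>2" using T T1 by (intro power_decreasing) auto
    then have "C3 * Q * T ^ 3 \<le> C3 * Q * T\<^sup>2" using C23 Q0 by (intro mult_left_mono) auto
    moreover have "0 \<le> C2 * T * D" using C23 T D0 by simp
    ultimately show ?thesis unfolding C23(3) by (simp add: algebra_simps power3_eq_cube power2_eq_square)
  qed
  moreover have "(1 - \<theta>) * D + C' * T * D \<le> (1 - \<alpha> * T / 2) * D"
    using mult_right_mono[OF T'(1) D0] by (simp add: algebra_simps)
  moreover have "C' * T\<^sup>2 * (P + D) \<le> \<alpha> * T / 4 * (P + D)"
  proof (rule mult_right_mono)
    have "T * (T * C') \<le> T * (\<alpha> / 4)" using T'(2) T by (intro mult_left_mono) auto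
    then show "C' * T\<^sup>2 \<le> \<alpha> * T / 4" by (simp add: power2_eq_square mult_ac)
  qed (use P0 D0 in simp)
  moreover have "C2 * T\<^sup>2 * Q + C3 * T\<^sup>2 * Q = C' * T\<^sup>2 * (P + D) + C' * Z\<^sup>2 * T\<^sup>2"
    unfolding C23(3) Q_def by (simp add: algebra_simps)
  moreover have "(1 - \<alpha> * T / 2) * P + (1 - \<alpha> * T / 2) * D + \<alpha> * T / 4 * (P + D)
      = (1 - \<alpha> * T / 4) * energy s"
    by (simp add: energy_def P_def D_def field_simps)
  ultimately show ?thesis by linarith
qed

text \<open>The energy is controlled only at sampling times; this carries the control to the times
  between two samples.\<close>

lemma norm_le_energy:
  assumes s: "0 \<le> s" and T: "0 < T" "real CARD('m) * T \<le> 1 / 2"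
    and Z: "\<And>i. \<bar>z $ i\<bar> \<le> Z" and t: "s \<le> t" "t \<le> s + T"
  shows "norm (x i t) \<le> real CARD('m) * (4 * sqrt (energy s) + 2 * T * Z)"
proof (rule norm_le_card_mult)
  fix l
  have le: "norm (mean s) \<le> sqrt (energy s)" "sqrt (disagreement s) \<le> sqrt (energy s)"
    using disagreement_nonneg by (auto simp: energy_def intro!: real_le_rsqrt)
  have "\<bar>x i t $ l\<bar> \<le> 2 * (norm (mean s) + sqrt (disagreement s)) + 2 * T * Z"
    by (rule window_bound(1)[OF s T component_le Z t])
  also have "\<dots> \<le> 4 * sqrt (energy s) + 2 * T * Z"
    using add_mono[OF le] by simp
  finally show "\<bar>x i t $ l\<bar> \<le> 4 * sqrt (energy s) + 2 * T * Z" .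
qed

lemma inner_gram: "v \<bullet> gram v = (norm (H *v v))\<^sup>2 / real CARD('n)"
proof -
  have "(norm (H *v v))\<^sup>2 = (\<Sum>i\<in>UNIV. (H $ i \<bullet> v)\<^sup>2)"
    by (simp add: norm_squared_eq_sum matrix_vector_mul_component)
  then show ?thesis
    by (simp add: gram_def inner_sum_right inner_commute[of v] power2_eq_square)
qed

text \<open>Along the sampling times k T the transient and the stationary part of the recursion each
  end up within \<kappa>^2 / 2, so the energy is eventually at most \<kappa>^2.\<close>

lemma eventually_norm_le:
  assumes T: "0 < T" "real CARD('m) * T \<le> 1 / 2" and q: "0 < q" "q \<le> 1" and b: "0 \<le> b"
    and step: "\<And>s. 0 \<le> s \<Longrightarrow> energy (s + T) \<le> (1 - q) * energy s + b"
    and \<kappa>: "0 < \<kappa>" "b / q \<le> \<kappa>\<^sup>2 / 2"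
    and Z: "\<And>i. \<bar>z $ i\<bar> \<le> Z"
    and \<epsilon>: "real CARD('m) * (4 * \<kappa> + 2 * T * Z) \<le> \<epsilon>"
  shows "\<forall>\<^sub>F t in at_top. norm (x i t) \<le> \<epsilon>"
proof -
  define u where "u k = energy (real k * T)" for k
  have "u (Suc k) \<le> (1 - q) * u k + b" for k
    using step[of "real k * T"] T by (simp add: u_def distrib_right add.commute)
  then have u: "u k \<le> (1 - q) ^ k * u 0 + b / q" for k
    by (rule affine_recursion_bound) (use q b in auto)
  have "(\<lambda>k. (1 - q) ^ k * u 0) \<longlonglongrightarrow> 0 * u 0"
    by (intro tendsto_mult LIMSEQ_realpow_zero tendsto_const) (use q in auto)
  then have "\<forall>\<^sub>F k in sequentially. (1 - q) ^ k * u 0 < \<kappa>\<^sup>2 / 2"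
    by (rule order_tendstoD) (use \<kappa> in simp)
  then obtain k0 where k0: "\<And>k. k0 \<le> k \<Longrightarrow> (1 - q) ^ k * u 0 < \<kappa>\<^sup>2 / 2"
    by (auto simp: eventually_sequentially)
  have "norm (x i t) \<le> \<epsilon>" if t: "real k0 * T \<le> t" for t
  proof -
    define k where "k = nat \<lfloor>t / T\<rfloor>"
    have "real k0 \<le> t / T" using t T by (simp add: pos_le_divide_eq)
    then have k0k: "k0 \<le> k" and "0 \<le> t / T" unfolding k_def by linarith+
    then have "real k \<le> t / T" "t / T < real k + 1" unfolding k_def by linarith+
    then have kt: "real k * T \<le> t" "t \<le> real k * T + T" using T by (auto simp: field_simps)
    have "energy (real k * T) \<le> \<kappa>\<^sup>2" using u[of k] k0[OF k0k] \<kappa>(2) unfolding u_def[of k, symmetric] by linarith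
    then have "sqrt (energy (real k * T)) \<le> \<kappa>" using \<kappa>(1) by (intro real_le_lsqrt) auto
    then have "real CARD('m) * (4 * sqrt (energy (real k * T)) + 2 * T * Z) \<le> real CARD('m) * (4 * \<kappa> + 2 * T * Z)"
      by (intro mult_left_mono) auto
    moreover have "norm (x i t) \<le> real CARD('m) * (4 * sqrt (energy (real k * T)) + 2 * T * Z)"
      using T by (intro norm_le_energy Z kt) auto
    ultimately show ?thesis using \<epsilon> by (blast intro: order_trans)
  qed
  then show ?thesis by (auto simp: eventually_at_top_linorder)
qed

end

theorem theorem7:
  fixes H :: "real^'m^'n" and ystar :: "real^'m" and z :: "real^'n" and \<delta> :: real
  assumes unit_rows: "\<forall>i. norm (H$i) = 1"
    and caseIII: "z \<notin> range (\<lambda>y. H *v y)"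
    and full_rank: "rank H = CARD('m)"
    and ystar: "ystar = matrix_inv (transpose H ** H) *v (transpose H *v z)"
    and "A1 H z" and "A2 H z"
    and "\<delta> > 0"
  shows "\<forall>\<epsilon>>0. \<forall>x0. (\<forall>i. (H$i) \<bullet> x0 i = z$i) \<longrightarrow>
           (\<exists>Kstar>0. \<exists>Tstar>0.
              \<forall>E a T K x. admissible_weights a \<and> balanced E a \<and> T > 0 \<and> UJSC E a \<delta> T \<and>
                 T \<le> Tstar \<and> K \<ge> Kstar \<and> is_trajectory H z K E a x0 x \<longrightarrow>
                 (\<forall>i. Limsup at_top (\<lambda>t::real. ereal (norm (x i t - ystar))) \<le> ereal \<epsilon>))"
proof (rule variance_contraction[OF \<open>\<delta> > 0\<close>, where 'n = 'n])
  fix C \<theta> :: real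
  assume C: "0 < C" and \<theta>: "\<theta> < 1" "0 < \<theta>"
    and contraction: "\<And>(y::'n \<Rightarrow> real \<Rightarrow> real) r f b s e M. balanced_flow y r f b s e M \<Longrightarrow>
      (\<And>A. A \<noteq> {} \<Longrightarrow> A \<noteq> UNIV \<Longrightarrow> \<exists>i\<in>A. \<exists>j\<in>-A.
        ennreal \<delta> \<le> (\<integral>\<^sup>+ t. ennreal (b i j t) * indicator {s..<e} t \<partial>lborel)) \<Longrightarrow>
      (\<Sum>i\<in>UNIV. (y i e - (\<Sum>i\<in>UNIV. y i e) / real CARD('n))\<^sup>2)
        \<le> (1 - \<theta>) * (\<Sum>i\<in>UNIV. (y i s - (\<Sum>i\<in>UNIV. y i s) / real CARD('n))\<^sup>2) + C * (M * (e - s))\<^sup>2"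
  show ?thesis
  proof (intro allI impI)
    fix \<epsilon> :: real and x0 :: "'n \<Rightarrow> real^'m"
    assume \<epsilon>: "0 < \<epsilon>"
    have normal: "(\<Sum>i\<in>UNIV. z $ i *\<^sub>R H $ i) = 0"
      using \<open>A2 H z\<close> by (simp add: A2_def proj_def)
    have "transpose H *v z = (\<Sum>i\<in>UNIV. z $ i *\<^sub>R H $ i)"
      by (simp add: vec_eq_iff matrix_vector_mult_def transpose_def mult.commute)
    then have ystar0: "ystar = 0" using normal ystar by simp
    define m where "m = real CARD('m)"
    define n where "n = real CARD('n)"
    \<comment> \<open>The added 1 keeps \<open>Z\<close> positive, since it occurs in denominators
      of \<open>Tstar\<close>.\<close>
    define Z where "Z = norm z + 1"
    have m: "0 < m" and n: "0 < n" by (simp_all add: m_def n_def)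
    have Z: "0 < Z" "\<bar>z $ i\<bar> \<le> Z" for i
      using component_le_norm_cart[of z i] norm_ge_zero[of z] by (simp_all add: Z_def add_nonneg_pos)
    have "inj ((*v) H)" using full_rank by (simp add: full_rank_injective)
    then obtain c where c: "c > 0" "\<And>v. c * norm v \<le> norm (H *v v)"
      using linear_inj_bounded_below_pos[OF matrix_vector_mul_linear] by blast
    \<comment> \<open>Full rank bounds \<open>H\<close> below by \<open>c\<close>, so the form v .
      H^T H v / N is coercive with constant c^2 / n; the cap at 1 ensures T \<le> 1 and \<alpha> T
      \<le> 1 later.\<close>
    define \<alpha> where "\<alpha> = min 1 (c\<^sup>2 / n)"
    have \<alpha>: "0 < \<alpha>" "\<alpha> \<le> 1" using c n by (auto simp: \<alpha>_def)
    define C' where "C' = 12 * real CARD('m) ^ 3 * C + 72 * real CARD('m) ^ 4 / \<alpha>"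
    have C': "0 < C'" unfolding C'_def using C \<alpha> by (intro add_pos_pos) auto
    \<comment> \<open>Chosen so that \<open>m * (4 * \<kappa>)\<close> is \<epsilon> / 2; the other
      half of \<epsilon> is left for the term 2 T Z m.\<close>
    define \<kappa> where "\<kappa> = \<epsilon> / (8 * m)"
    have \<kappa>: "0 < \<kappa>" using \<epsilon> m by (simp add: \<kappa>_def)
    \<comment> \<open>In order: \<open>window_bound\<close> closes; the Euler step contracts; the
      two absorptions in \<open>window_energy_step\<close> hold; the stationary level 4 C' Z^2 T /
      \<alpha> is at most \<kappa>^2 / 2; and the drift between samples, 2 T Z m, is at most
      \<epsilon> / 2.\<close>
    define Tstar where "Tstar = Min {1 / (2 * m), \<alpha>, \<theta> / (C' + \<alpha> / 2), \<alpha> / (4 * C'),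
      \<kappa>\<^sup>2 * \<alpha> / (8 * C' * Z\<^sup>2), \<epsilon> / (4 * m * Z)}"
    have Tstar: "0 < Tstar"
      using m \<alpha> \<theta> C' \<kappa> Z(1) \<epsilon> by (simp add: Tstar_def)
    have "\<forall>i. Limsup at_top (\<lambda>t. ereal (norm (x i t - ystar))) \<le> ereal \<epsilon>"
      if weights: "admissible_weights a" and bal: "balanced E a" and T: "0 < T" and ujsc: "UJSC E a \<delta> T"
        and T_le: "T \<le> Tstar" and K: "1 \<le> K" and traj: "is_trajectory H z K E a x0 x"
      for E a T K x
    proof
      fix i
      interpret projection_consensus H z K E a x0 x
        using unit_rows normal K weights bal traj by unfold_locales auto
      have "T \<le> 1 / (2 * m)" "T \<le> \<alpha>" "T \<le> \<theta> / (C' + \<alpha> / 2)" "T \<le> \<alpha> / (4 * C')"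
        "T \<le> \<kappa>\<^sup>2 * \<alpha> / (8 * C' * Z\<^sup>2)" "T \<le> \<epsilon> / (4 * m * Z)"
        using T_le by (simp_all add: Tstar_def)
      then have Ts: "m * T \<le> 1 / 2" "T \<le> \<alpha>" "T * (C' + \<alpha> / 2) \<le> \<theta>" "T * C' \<le> \<alpha> / 4"
        "T * (8 * C' * Z\<^sup>2) \<le> \<kappa>\<^sup>2 * \<alpha>" "T * (4 * m * Z) \<le> \<epsilon>"
        using m \<alpha>(1) C' Z(1) by (simp_all add: pos_le_divide_eq mult_ac)
      have coercive: "\<alpha> * (norm v)\<^sup>2 \<le> v \<bullet> gram v" for v
      proof -
        have "\<alpha> * (norm v)\<^sup>2 \<le> c\<^sup>2 / n * (norm v)\<^sup>2" by (intro mult_right_mono) (auto simp: \<alpha>_def)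
        also have "\<dots> = (c * norm v)\<^sup>2 / n" by (simp add: power_mult_distrib)
        also have "\<dots> \<le> (norm (H *v v))\<^sup>2 / n"
          using c n by (intro divide_right_mono power_mono) auto
        finally show ?thesis by (simp add: inner_gram n_def)
      qed
      have step: "energy (s + T) \<le> (1 - \<alpha> * T / 4) * energy s + C' * Z\<^sup>2 * T\<^sup>2" if s: "0 \<le> s" for s
      proof (rule window_energy_step[OF s T _ Ts(2) \<alpha> coercive Z(2) \<theta>(1) C _ C'_def Ts(3,4)])
        fix l M
        assume "balanced_flow (\<lambda>i t. x i t $ l) (\<lambda>i t. flow_rhs H z K E a x i t $ l)
          (force l) arc_weight s (s + T) M"
        from contraction[OF this window_arcs[OF ujsc s]]
        show "(\<Sum>i\<in>UNIV. (x i (s + T) $ l - (\<Sum>i\<in>UNIV. x i (s + T) $ l) / real CARD('n))\<^sup>2)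
          \<le> (1 - \<theta>) * (\<Sum>i\<in>UNIV. (x i s $ l - (\<Sum>i\<in>UNIV. x i s $ l) / real CARD('n))\<^sup>2) + C * (M * T)\<^sup>2"
          by simp
      qed (use Ts(1) in \<open>simp add: m_def\<close>)
      have "\<forall>\<^sub>F t in at_top. norm (x i t) \<le> \<epsilon>"
      proof (rule eventually_norm_le[OF T _ _ _ _ step \<kappa> _ Z(2)])
        show "real CARD('m) * T \<le> 1 / 2" using Ts(1) by (simp add: m_def)
        show "0 < \<alpha> * T / 4" using \<alpha> T by simp
        have "\<alpha> * T \<le> 1 * 1" using \<alpha> T Ts(2) by (intro mult_mono) auto
        then show "\<alpha> * T / 4 \<le> 1" by simp
        show "0 \<le> C' * Z\<^sup>2 * T\<^sup>2" using C' by simp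
        have "C' * Z\<^sup>2 * T\<^sup>2 / (\<alpha> * T / 4) = T * (8 * C' * Z\<^sup>2) / \<alpha> / 2"
          using T \<alpha> by (simp add: power2_eq_square field_simps)
        also have "\<dots> \<le> \<kappa>\<^sup>2 / 2"
          using Ts(5) \<alpha> by (intro divide_right_mono) (simp_all only: pos_divide_le_eq zero_le_numeral)
        finally show "C' * Z\<^sup>2 * T\<^sup>2 / (\<alpha> * T / 4) \<le> \<kappa>\<^sup>2 / 2" .
        have "m * (4 * \<kappa>) = \<epsilon> / 2" using m by (simp add: \<kappa>_def)
        then show "real CARD('m) * (4 * \<kappa> + 2 * T * Z) \<le> \<epsilon>"
          using Ts(6) unfolding m_def[symmetric] by (simp add: distrib_left mult_ac)
      qed
      then have "\<forall>\<^sub>F t in at_top. ereal (norm (x i t - ystar)) \<le> ereal \<epsilon>"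
        by (simp add: ystar0)
      then show "Limsup at_top (\<lambda>t. ereal (norm (x i t - ystar))) \<le> ereal \<epsilon>"
        by (rule Limsup_bounded)
    qed
    then show "\<exists>Kstar>0. \<exists>Tstar>0.
        \<forall>E a T K x. admissible_weights a \<and> balanced E a \<and> T > 0 \<and> UJSC E a \<delta> T \<and>
           T \<le> Tstar \<and> K \<ge> Kstar \<and> is_trajectory H z K E a x0 x \<longrightarrow>
           (\<forall>i. Limsup at_top (\<lambda>t::real. ereal (norm (x i t - ystar))) \<le> ereal \<epsilon>)"
      using Tstar by (intro exI[of _ 1] exI[of _ Tstar] conjI) auto
  qed
qed

end
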